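(* For $k=2$ the density $\tilde p_2(R)=-\frac{d}{dR}\tilde P_2(R)$ is given by $$\tilde p_2(R)=\begin{cases}0 & (0\le R\le\frac1{\sqrt2})\\[4pt] \dfrac{24}{\pi^2}\left(\dfrac{2R^2-1}{R}\log\Big(\dfrac{2R^2}{2R^2-1}\Big)+\dfrac{1-R^2}{R}\log\Big(\dfrac{R^2}{|1-R^2|}\Big)\right) & (R>\frac1{\sqrt2}),\end{cases}$$ where the term $\frac{1-R^2}{R}\log\big(\frac{R^2}{|1-R^2|}\big)$ is understood as its limit value $0$ at $R=1$.
   Context: $X_2$ is the set of all lattices $L\subset\mathbb{R}^2$ of covolume one, identified with $\mathrm{SL}(2,\mathbb{Z})\backslash\mathrm{SL}(2,\mathbb{R})$ via $\mathrm{SL}(2,\mathbb{Z})M\mapsto\mathbb{Z}^2M$ (row vectors), and $\mu_0$ is the $\mathrm{SL}(2,\mathbb{R})$-invariant probability measure on $X_2$. For a closed bounded convex set $K\subset\mathbb{R}^2$ of nonzero volume and a lattice $L\subset\mathbb{R}^2$, the covering radius is $\rho(K,L)=\inf\{r>0: rK+L=\mathbb{R}^2\}$. Set $\mathfrak{P}=\{x\in\mathbb{R}^2:|x_1|+|x_2|\le1\}$ and, for $R\ge0$, $\tilde P_2(R)=\mu_0(\{L\in X_2:\rho(\mathfrak{P},L)>R\})$. *)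

theory Defs
  imports "HOL-Probability.Probability"
begin

definition int_lattice :: "real^2^2 \<Rightarrow> (real^2) set" where
  "int_lattice M = (\<lambda>v. v v* M) ` {v. \<forall>i. v $ i \<in> \<int>}"

definition SL2R :: "(real^2^2) set" where
  "SL2R = {M. det M = 1}"

definition X2 :: "(real^2) set set" where
  "X2 = {L. \<exists>M. \<bar>det M\<bar> = 1 \<and> L = int_lattice M}"

lemma X2_eq_image_SL2R: "X2 = int_lattice ` SL2R"
proof
  show "int_lattice ` SL2R \<subseteq> X2"
    unfolding X2_def SL2R_def by (rule image_subsetI, rule CollectI, rule exI, rule conjI[OF _ refl]) simp
  show "X2 \<subseteq> int_lattice ` SL2R"
  proof
    fix L assume "L \<in> X2"
    then obtain M where M: "\<bar>det M\<bar> = 1" and L: "L = int_lattice M"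
      by (auto simp: X2_def)
    show "L \<in> int_lattice ` SL2R"
    proof (cases "det M = 1")
      case True
      then show ?thesis using L unfolding SL2R_def by blast
    next
      case False
      with M have d: "det M = -1" by linarith
      define N :: "real^2^2" where "N = (\<chi> i j. if i = 1 then - (M $ i $ j) else M $ i $ j)"
      have dN: "det N = 1"
        using d by (simp add: det_2 N_def)
      define s :: "real^2 \<Rightarrow> real^2" where "s v = (\<chi> i. if i = 1 then - (v $ i) else v $ i)" for v
      have sN: "v v* N = s v v* M" for v
        by (simp add: vec_eq_iff vector_matrix_mult_def sum_2 N_def s_def)
      have ss: "s (s v) = v" for v
        by (simp add: vec_eq_iff s_def)
      have si: "\<forall>i. s v $ i \<in> \<int>" if "\<forall>i. v $ i \<in> \<int>" for v
        using that by (simp add: s_def)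
      have "s ` {v. \<forall>i. v $ i \<in> \<int>} = {v. \<forall>i. v $ i \<in> \<int>}" (is "s ` ?Z = ?Z")
      proof
        show "s ` ?Z \<subseteq> ?Z" using si by blast
        show "?Z \<subseteq> s ` ?Z"
        proof
          fix v assume "v \<in> ?Z"
          then have "s v \<in> ?Z" using si by blast
          then show "v \<in> s ` ?Z" using ss[of v] by (metis imageI)
        qed
      qed
      then have "int_lattice M = (\<lambda>v. v v* M) ` s ` ?Z"
        by (simp only: int_lattice_def)
      also have "\<dots> = int_lattice N"
        unfolding int_lattice_def image_image sN ..
      finally have "int_lattice N = L"
        using L by simp
      with dN show ?thesis unfolding SL2R_def by blast
    qed
  qed
qed

text \<open>The Borel \<sigma>-algebra of the quotient topology that X2 carries as
  SL(2,Z) \ SL(2,R): a set of lattices is open iff its preimage under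
  \<^const>\<open>int_lattice\<close> is open in SL(2,R).\<close>

definition X2_borel :: "(real^2) set measure" where
  "X2_borel = sigma X2 {U. U \<subseteq> X2 \<and> openin (top_of_set SL2R) {M \<in> SL2R. int_lattice M \<in> U}}"

definition lattice_act :: "real^2^2 \<Rightarrow> (real^2) set \<Rightarrow> (real^2) set" where
  "lattice_act A L = (\<lambda>v. v v* A) ` L"

text \<open>Exactly one measure satisfies this: the push-forward to X2 of the normalised
  Haar measure on SL(2,Z) \ SL(2,R). All transported sets are measurable, since each
  \<^const>\<open>lattice_act\<close> with matrix in SL(2,R) is a homeomorphism of X2.\<close>

definition is_invariant_prob :: "(real^2) set measure \<Rightarrow> bool" where
  "is_invariant_prob \<mu> \<longleftrightarrow>
     sets \<mu> = sets X2_borel \<and> prob_space \<mu> \<and>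
     (\<forall>A\<in>SL2R. distr \<mu> \<mu> (lattice_act A) = \<mu>)"

text \<open>The sum of the scaled body and the lattice is the pointwise (Minkowski) sum.\<close>

definition covering_radius :: "(real^2) set \<Rightarrow> (real^2) set \<Rightarrow> real" where
  "covering_radius K L = Inf {r. 0 < r \<and> (\<lambda>x. r *\<^sub>R x) ` K + L = UNIV}"

definition cross_polytope :: "(real^2) set" where
  "cross_polytope = {x. \<bar>x $ 1\<bar> + \<bar>x $ 2\<bar> \<le> 1}"

definition P2 :: "(real^2) set measure \<Rightarrow> real \<Rightarrow> real" where
  "P2 \<mu> R = measure \<mu> {L \<in> X2. covering_radius cross_polytope L > R}"

definition p2 :: "real \<Rightarrow> real" where
  "p2 R = (if R \<le> 1 / sqrt 2 then 0
     else 24 / pi^2 *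
       ((2 * R^2 - 1) / R * ln (2 * R^2 / (2 * R^2 - 1)) +
        (if R = 1 then 0 else (1 - R^2) / R * ln (R^2 / \<bar>1 - R^2\<bar>))))"

end

theory Submission
  imports Defs "HOL-Real_Asymp.Real_Asymp"
begin

text \<open>
  Let \<open>R > 0\<close> and \<open>T = 2 R\<^sup>2\<close>. A matrix of determinant one (\<open>box_frame\<close>) maps the diamond of radius \<open>R\<close> onto a
  \<open>T\<close> by \<open>1\<close> box, and the measure on lattices is invariant. So the question is with which probability some
  translate of this box contains no point of a random unimodular lattice \<open>L\<close>.

  If \<open>L\<close> has no nonzero point on the coordinate axes, the answer can be read off from one canonical basis. Let
  \<open>v = (a, \<alpha>)\<close> be the leftmost lattice point in the half-strip \<open>x > 0\<close>, \<open>0 < y \<le> 1\<close>, and \<open>w = (b, - \<beta>)\<close> the leftmost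
  one in \<open>x > 0\<close>, \<open>-1 \<le> y < 0\<close>. These two points form a basis, and \<open>\<alpha> + \<beta> > 1\<close> (\<open>cell_basis_exists\<close>,
  \<open>cell_basis_unique\<close>). There is an open rectangle of width \<open>a + b\<close> and height \<open>\<alpha> + \<beta>\<close> without lattice points,
  whereas consecutive lattice points in a horizontal strip of height one are at most \<open>a + b\<close> apart in the
  horizontal direction. Hence all translates of the box meet \<open>L\<close> if and only if \<open>a + b \<le> T\<close>
  (\<open>wide_cell_not_covering\<close>, \<open>narrow_cell_covering\<close>).

  It remains to find the distribution of \<open>a + b\<close>. Replacing each lattice by the counting measure on its bases
  turns the given probability into a measure on \<open>SL(2, \<real>)\<close> that is invariant under right multiplication.
  By uniqueness of Haar measure (\<open>haar_unique\<close>) it is proportional to the measure \<open>d\<alpha> d\<beta> db / \<beta>\<close>. The set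
  \<open>cell\<close> of all canonical bases contains exactly one basis of almost every lattice, so it has measure one; its
  Haar measure is the integral of \<open>1 / (\<alpha> \<beta>)\<close> over the triangle \<open>\<alpha>, \<beta> \<le> 1 < \<alpha> + \<beta>\<close>, which is the sum of the
  inverse squares (\<open>haar_cell\<close>). This gives the factor \<open>6 / pi\<^sup>2\<close>.

  With \<open>t = a + b\<close> as a coordinate in place of \<open>b\<close>, Haar measure is \<open>d\<alpha> d\<beta> dt / \<bar>\<beta> - \<alpha>\<bar>\<close> on the set where \<open>1 / t\<close> lies
  between \<open>\<alpha>\<close> and \<open>\<beta>\<close>. Integrating over \<open>\<alpha>\<close> and \<open>\<beta>\<close> leaves a continuous density in \<open>t\<close> that consists of the two
  logarithmic terms of the claim (\<open>slab_integral\<close>), and differentiating the probability of \<open>a + b > 2 R\<^sup>2\<close> with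
  respect to \<open>R\<close> gives the formula.
\<close>

section \<open>Two by two matrices\<close>

definition mat2 :: "real \<Rightarrow> real \<Rightarrow> real \<Rightarrow> real \<Rightarrow> real^2^2" where
  "mat2 p q r s = (\<chi> i j. if i = 1 then (if j = 1 then p else q) else (if j = 1 then r else s))"

lemma mat2_nth [simp]:
  "mat2 p q r s $ 1 $ 1 = p" "mat2 p q r s $ 1 $ 2 = q"
  "mat2 p q r s $ 2 $ 1 = r" "mat2 p q r s $ 2 $ 2 = s"
  by (simp_all add: mat2_def)

lemma matrix_2_eq_iff: "(M :: real^2^2) = N \<longleftrightarrow>
    M$1$1 = N$1$1 \<and> M$1$2 = N$1$2 \<and> M$2$1 = N$2$1 \<and> M$2$2 = N$2$2"
  by (auto simp: vec_eq_iff forall_2)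

lemma mat2_eta: "mat2 (M$1$1) (M$1$2) (M$2$1) (M$2$2) = M"
  by (simp add: matrix_2_eq_iff)

lemma mult_nth_2:
  fixes A B :: "real^2^2"
  shows "(A ** B)$i$j = A$i$1 * B$1$j + A$i$2 * B$2$j"
  by (simp add: matrix_matrix_mult_def sum_2)

lemma vmult_nth_2:
  fixes v :: "real^2" and A :: "real^2^2"
  shows "(v v* A)$j = v$1 * A$1$j + v$2 * A$2$j"
  by (simp add: vector_matrix_mult_def sum_2 mult.commute)

lemma mat2_mult: "mat2 p q r s ** mat2 a b c d =
    mat2 (p * a + q * c) (p * b + q * d) (r * a + s * c) (r * b + s * d)"
  by (simp add: matrix_2_eq_iff mult_nth_2)

definition adj2 :: "real^2^2 \<Rightarrow> real^2^2" where
  "adj2 M = mat2 (M$2$2) (- (M$1$2)) (- (M$2$1)) (M$1$1)"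

lemma det_adj2 [simp]: "det (adj2 M) = det M"
  by (simp add: adj2_def det_2 mult.commute)

lemma SL2R_det: "M \<in> SL2R \<longleftrightarrow> M$1$1 * M$2$2 - M$1$2 * M$2$1 = 1"
  by (simp add: SL2R_def det_2)

lemma adj2_inverse:
  assumes "M \<in> SL2R"
  shows "adj2 M ** M = mat 1" "M ** adj2 M = mat 1"
  using assms by (auto simp: SL2R_det matrix_2_eq_iff mult_nth_2 adj2_def mat_def algebra_simps)

lemma SL2R_mult: "A \<in> SL2R \<Longrightarrow> B \<in> SL2R \<Longrightarrow> A ** B \<in> SL2R"
  by (simp add: SL2R_def det_mul)

lemma SL2R_adj2: "A \<in> SL2R \<Longrightarrow> adj2 A \<in> SL2R"
  by (simp add: SL2R_def)

lemma mult_adj2_cancel [simp]: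
  assumes "A \<in> SL2R"
  shows "M ** A ** adj2 A = M" "M ** adj2 A ** A = M" "A ** (adj2 A ** M) = M" "adj2 A ** (A ** M) = M"
proof -
  show "M ** A ** adj2 A = M" "M ** adj2 A ** A = M"
    using assms by (metis adj2_inverse matrix_mul_assoc matrix_mul_rid)+
  show "A ** (adj2 A ** M) = M" "adj2 A ** (A ** M) = M"
    using assms by (metis adj2_inverse matrix_mul_assoc matrix_mul_lid)+
qed

lemma continuous_on_mat2 [continuous_intros]:
  assumes "continuous_on S f" "continuous_on S g" "continuous_on S h" "continuous_on S k"
  shows "continuous_on S (\<lambda>x. mat2 (f x) (g x) (h x) (k x))"
proof -
  have "(\<lambda>x. mat2 (f x) (g x) (h x) (k x)) =
    (\<lambda>x. f x *\<^sub>R mat2 1 0 0 0 + g x *\<^sub>R mat2 0 1 0 0 + h x *\<^sub>R mat2 0 0 1 0 + k x *\<^sub>R mat2 0 0 0 1)"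
    by (rule ext) (simp add: matrix_2_eq_iff)
  then show ?thesis by (simp only:) (intro continuous_intros assms)
qed

lemma continuous_on_matmul2 [continuous_intros]:
  assumes "continuous_on S f" "continuous_on S g"
  shows "continuous_on S (\<lambda>x. f x ** (g x :: real^2^2) :: real^2^2)"
proof -
  have "(\<lambda>x. f x ** g x) = (\<lambda>x. mat2 (f x$1$1 * g x$1$1 + f x$1$2 * g x$2$1)
     (f x$1$1 * g x$1$2 + f x$1$2 * g x$2$2) (f x$2$1 * g x$1$1 + f x$2$2 * g x$2$1)
     (f x$2$1 * g x$1$2 + f x$2$2 * g x$2$2))"
    by (rule ext) (simp add: matrix_2_eq_iff mult_nth_2)
  then show ?thesis by (simp only:) (intro continuous_intros assms)
qed

lemma measurable_mat2 [measurable]: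
  assumes [measurable]: "f \<in> borel_measurable M" "g \<in> borel_measurable M"
    "h \<in> borel_measurable M" "k \<in> borel_measurable M"
  shows "(\<lambda>x. mat2 (f x) (g x) (h x) (k x)) \<in> borel_measurable M"
proof -
  have "(\<lambda>x. mat2 (f x) (g x) (h x) (k x)) =
    (\<lambda>x. f x *\<^sub>R mat2 1 0 0 0 + g x *\<^sub>R mat2 0 1 0 0 + h x *\<^sub>R mat2 0 0 1 0 + k x *\<^sub>R mat2 0 0 0 1)"
    by (rule ext) (simp add: matrix_2_eq_iff)
  then show ?thesis by simp
qed

lemma measurable_entry [measurable]: "(\<lambda>M :: real^2^2. M$i$j) \<in> borel_measurable borel"
  by (intro borel_measurable_continuous_onI continuous_intros)

lemma measurable_entry_comp [measurable (raw)]: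
  "f \<in> borel_measurable N \<Longrightarrow> (\<lambda>x. (f x :: real^2^2)$i$j) \<in> borel_measurable N"
  using measurable_compose[OF _ measurable_entry] by blast

lemma measurable_matmul2 [measurable (raw)]:
  assumes [measurable]: "f \<in> borel_measurable M" "g \<in> borel_measurable M"
  shows "(\<lambda>x. f x ** (g x :: real^2^2) :: real^2^2) \<in> borel_measurable M"
proof -
  have "(\<lambda>x. f x ** g x) = (\<lambda>x. mat2 (f x$1$1 * g x$1$1 + f x$1$2 * g x$2$1)
     (f x$1$1 * g x$1$2 + f x$1$2 * g x$2$2) (f x$2$1 * g x$1$1 + f x$2$2 * g x$2$1)
     (f x$2$1 * g x$1$2 + f x$2$2 * g x$2$2))"
    by (rule ext) (simp add: matrix_2_eq_iff mult_nth_2)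
  then show ?thesis by simp
qed

lemma measurable_adj2 [measurable]: "adj2 \<in> borel_measurable borel"
  unfolding adj2_def[abs_def] by measurable

lemma closed_SL2R: "closed SL2R"
proof -
  have "SL2R = {M. M$1$1 * M$2$2 - M$1$2 * M$2$1 = 1}"
    by (auto simp: SL2R_det)
  moreover have "closed {M :: real^2^2. M$1$1 * M$2$2 - M$1$2 * M$2$1 = 1}"
    by (intro closed_Collect_eq continuous_intros)
  ultimately show ?thesis by metis
qed

lemma SL2R_borel [measurable]: "SL2R \<in> sets borel"
  using closed_SL2R by (rule borel_closed)

section \<open>Bases of a lattice\<close>

definition bases :: "(real^2) set \<Rightarrow> (real^2^2) set" where
  "bases L = {M \<in> SL2R. int_lattice M = L}"

definition SL2Z :: "(real^2^2) set" where
  "SL2Z = {G \<in> SL2R. \<forall>i j. G$i$j \<in> \<int>}"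

lemma SL2Z_adj2: "G \<in> SL2Z \<Longrightarrow> adj2 G \<in> SL2Z"
  by (auto simp: SL2Z_def SL2R_adj2 forall_2) (auto simp: adj2_def)

lemma int_lattice_SL2Z_subset:
  assumes "\<forall>i j. G$i$j \<in> \<int>"
  shows "int_lattice (G ** M) \<subseteq> int_lattice M"
proof -
  have "\<forall>i. (v v* G)$i \<in> \<int>" if "\<forall>i. v$i \<in> \<int>" for v
    using that assms by (auto simp: vmult_nth_2)
  then show ?thesis
    unfolding int_lattice_def by (auto simp: vector_matrix_mul_assoc[symmetric])
qed

lemma int_lattice_SL2Z:
  assumes "G \<in> SL2Z"
  shows "int_lattice (G ** M) = int_lattice M"
proof
  show "int_lattice (G ** M) \<subseteq> int_lattice M"
    using assms by (intro int_lattice_SL2Z_subset) (auto simp: SL2Z_def)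
  have "int_lattice (adj2 G ** (G ** M)) \<subseteq> int_lattice (G ** M)"
    using SL2Z_adj2[OF assms] by (intro int_lattice_SL2Z_subset) (auto simp: SL2Z_def)
  then show "int_lattice M \<subseteq> int_lattice (G ** M)"
    using assms by (simp add: SL2Z_def)
qed

lemma row_in_int_lattice: "M$i \<in> int_lattice M"
proof -
  have "M$i = axis i 1 v* M"
    using exhaust_2[of i] by (auto simp: vec_eq_iff forall_2 vmult_nth_2 axis_def)
  moreover have "\<forall>j. (axis i 1 :: real^2)$j \<in> \<int>" by (simp add: axis_def)
  ultimately show ?thesis unfolding int_lattice_def by blast
qed

text \<open>The rows of each basis are integer combinations of the rows of the other one, and the
  determinant of the transition matrix is the quotient of two equal determinants.\<close>

lemma int_lattice_eq_iff:
  assumes "M \<in> SL2R" "N \<in> SL2R"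
  shows "int_lattice N = int_lattice M \<longleftrightarrow> (\<exists>G\<in>SL2Z. N = G ** M)"
proof
  assume eq: "int_lattice N = int_lattice M"
  have "\<forall>i. \<exists>v. (\<forall>j. v$j \<in> \<int>) \<and> N$i = v v* M"
    using row_in_int_lattice[of N] eq by (fastforce simp: int_lattice_def)
  then obtain g where g: "\<And>i j. g i$j \<in> \<int>" "\<And>i. N$i = g i v* M"
    by metis
  define G :: "real^2^2" where "G = (\<chi> i. g i)"
  have "N = G ** M"
    by (auto simp: vec_eq_iff mult_nth_2 G_def g(2) vmult_nth_2)
  moreover from this have "det G = 1"
    using assms by (simp add: SL2R_def det_mul)
  ultimately show "\<exists>G\<in>SL2Z. N = G ** M"
    using g(1) by (intro bexI[of _ G]) (auto simp: SL2Z_def SL2R_def G_def)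
qed (auto simp: int_lattice_SL2Z)

lemma bases_int_lattice:
  assumes "M \<in> SL2R"
  shows "bases (int_lattice M) = (\<lambda>G. G ** M) ` SL2Z"
  using assms int_lattice_eq_iff[OF assms]
  by (auto simp: bases_def int_lattice_SL2Z) (auto simp: SL2R_mult SL2Z_def)

lemma lattice_act_int_lattice: "lattice_act A (int_lattice M) = int_lattice (M ** A)"
  by (simp add: lattice_act_def int_lattice_def image_image vector_matrix_mul_assoc)

lemma X2_iff: "L \<in> X2 \<longleftrightarrow> (\<exists>M\<in>SL2R. L = int_lattice M)"
  by (auto simp: X2_eq_image_SL2R)

lemma lattice_act_X2: "A \<in> SL2R \<Longrightarrow> L \<in> X2 \<Longrightarrow> lattice_act A L \<in> X2"
  by (auto simp: X2_iff lattice_act_int_lattice intro: SL2R_mult)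

lemma lattice_act_adj2:
  assumes "A \<in> SL2R" "L \<in> X2"
  shows "lattice_act (adj2 A) (lattice_act A L) = L" "lattice_act A (lattice_act (adj2 A) L) = L"
  using assms by (auto simp: X2_iff lattice_act_int_lattice)

lemma bases_lattice_act:
  assumes "A \<in> SL2R" "L \<in> X2"
  shows "M \<in> bases (lattice_act A L) \<longleftrightarrow> M ** adj2 A \<in> bases L"
proof -
  have "M \<in> SL2R \<longleftrightarrow> M ** adj2 A \<in> SL2R"
    using assms(1) by (auto simp: SL2R_def det_mul)
  moreover have "int_lattice (M ** adj2 A) = L \<longleftrightarrow> int_lattice M = lattice_act A L"
    using assms lattice_act_adj2[OF assms]
    by (metis lattice_act_int_lattice mult_adj2_cancel(2))
  ultimately show ?thesis by (auto simp: bases_def)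
qed

lemma inj_mult_right: "M \<in> SL2R \<Longrightarrow> inj_on (\<lambda>G :: real^2^2. G ** M) S"
  by (rule inj_on_inverseI[where g="\<lambda>N. N ** adj2 M"]) simp

lemma finite_bounded_integer_matrices:
  "finite {G :: real^2^2. (\<forall>i j. G$i$j \<in> \<int>) \<and> (\<forall>i j. \<bar>G$i$j\<bar> \<le> K)}"
proof -
  have fin: "finite {x :: real. x \<in> \<int> \<and> \<bar>x\<bar> \<le> K}"
    by (rule finite_abs_int_segment)
  let ?I = "{x :: real. x \<in> \<int> \<and> \<bar>x\<bar> \<le> K}"
  have "{G :: real^2^2. (\<forall>i j. G$i$j \<in> \<int>) \<and> (\<forall>i j. \<bar>G$i$j\<bar> \<le> K)} \<subseteq>
     (\<lambda>(p,q,r,s). mat2 p q r s) ` (?I \<times> ?I \<times> ?I \<times> ?I)"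
  proof
    fix G :: "real^2^2" assume "G \<in> {G. (\<forall>i j. G$i$j \<in> \<int>) \<and> (\<forall>i j. \<bar>G$i$j\<bar> \<le> K)}"
    then show "G \<in> (\<lambda>(p,q,r,s). mat2 p q r s) ` (?I \<times> ?I \<times> ?I \<times> ?I)"
      by (intro image_eqI[of _ _ "(G$1$1,G$1$2,G$2$1,G$2$2)"]) (auto simp: mat2_eta)
  qed
  then show ?thesis using fin by (meson finite_SigmaI finite_imageI finite_subset)
qed

text \<open>Two bases \<open>M\<close>, \<open>N\<close> of one lattice differ by the integer matrix \<open>N M\<^sup>-\<^sup>1\<close>. If both lie in \<open>B\<close>, its entries
  are bounded in terms of \<open>B\<close> alone, so the number of bases in \<open>B\<close> is bounded uniformly in the lattice.\<close>

lemma card_bases_bounded: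
  assumes "bounded B"
  obtains C where "\<And>L. finite (B \<inter> bases L)" "\<And>L. card (B \<inter> bases L) \<le> C"
proof -
  obtain b where b: "\<And>M. M \<in> B \<Longrightarrow> norm M \<le> b" and "b > 0"
    using assms bounded_pos by blast
  have ent: "\<bar>M$i$j\<bar> \<le> b" if "M \<in> B" for M i j
    using b[OF that] component_le_norm_cart[of "M$i" j] Finite_Cartesian_Product.norm_nth_le[of M i] by linarith
  let ?\<Gamma> = "{G :: real^2^2. (\<forall>i j. G$i$j \<in> \<int>) \<and> (\<forall>i j. \<bar>G$i$j\<bar> \<le> 2*b^2)}"
  have *: "\<exists>M. B \<inter> bases L \<subseteq> (\<lambda>G. G ** M) ` ?\<Gamma>" for L
  proof (cases "B \<inter> bases L = {}")
    case False
    then obtain M where M: "M \<in> B" "M \<in> SL2R" "L = int_lattice M"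
      by (auto simp: bases_def)
    have "N \<in> (\<lambda>G. G ** M) ` ?\<Gamma>" if N: "N \<in> B" "N \<in> bases L" for N
    proof -
      obtain G where G: "G \<in> SL2Z" "N = G ** M"
        using N M by (auto simp: bases_int_lattice)
      have "G = N ** adj2 M" using G M by simp
      have a: "\<bar>adj2 M$i$j\<bar> \<le> b" for i j
        using ent[OF M(1)] exhaust_2[of i] exhaust_2[of j] by (auto simp: adj2_def)
      have "\<bar>G$i$j\<bar> \<le> 2*b^2" for i j
      proof -
        have m: "\<bar>N$i$k * adj2 M$k$j\<bar> \<le> b^2" for k
          unfolding abs_mult power2_eq_square
          by (intro mult_mono a ent N) (use \<open>b > 0\<close> in auto)
        show ?thesis
          unfolding \<open>G = N ** adj2 M\<close> mult_nth_2 using m[of 1] m[of 2] by linarith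
      qed
      then show ?thesis using G by (auto simp: SL2Z_def)
    qed
    then show ?thesis by blast
  qed auto
  have fin: "finite ?\<Gamma>" by (rule finite_bounded_integer_matrices)
  show ?thesis
  proof
    fix L
    obtain M where M: "B \<inter> bases L \<subseteq> (\<lambda>G. G ** M) ` ?\<Gamma>" using * by blast
    then show "finite (B \<inter> bases L)" using fin by (meson finite_imageI finite_subset)
    show "card (B \<inter> bases L) \<le> card ?\<Gamma>"
      using M fin by (meson card_image_le card_mono finite_imageI le_trans)
  qed
qed

text \<open>A matrix of the cell has the rows \<open>w = (b, - \<beta>)\<close> and \<open>v = (a, \<alpha>)\<close>, where \<open>a\<close>, \<open>b\<close>, \<open>\<alpha>\<close>, \<open>\<beta>\<close> are
  positive and \<open>\<alpha>, \<beta> \<le> 1 < \<alpha> + \<beta>\<close>. With \<open>w\<close> as the first row the determinant \<open>b \<alpha> + a \<beta>\<close> is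
  positive.\<close>

definition cell :: "(real^2^2) set" where
  "cell = {M. 0 < M$1$1 \<and> 0 < M$2$1 \<and> -1 \<le> M$1$2 \<and> M$1$2 < 0 \<and> 0 < M$2$2 \<and> M$2$2 \<le> 1 \<and>
              1 < M$2$2 - M$1$2}"

lemma cell_borel [measurable]: "cell \<in> sets borel"
  unfolding cell_def by measurable

lemma int_lattice_iff: "u \<in> int_lattice M \<longleftrightarrow>
   (\<exists>(m::int) (n::int). u$1 = m * M$1$1 + n * M$2$1 \<and> u$2 = m * M$1$2 + n * M$2$2)"
proof
  assume "u \<in> int_lattice M"
  then obtain v where v: "\<forall>i. v$i \<in> \<int>" "u = v v* M" by (auto simp: int_lattice_def)
  obtain m n :: int where "v$1 = m" "v$2 = n" using v(1) by (metis Ints_cases)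
  then show "\<exists>(m::int) (n::int). u$1 = m * M$1$1 + n * M$2$1 \<and> u$2 = m * M$1$2 + n * M$2$2"
    using v(2) by (auto simp: vmult_nth_2)
next
  assume "\<exists>(m::int) (n::int). u$1 = m * M$1$1 + n * M$2$1 \<and> u$2 = m * M$1$2 + n * M$2$2"
  then obtain m n :: int where *: "u$1 = m * M$1$1 + n * M$2$1" "u$2 = m * M$1$2 + n * M$2$2" by blast
  define v :: "real^2" where "v = vector [of_int m, of_int n]"
  have "\<forall>i. v$i \<in> \<int>" by (simp add: v_def forall_2)
  moreover have "u = v v* M" using * by (simp add: vec_eq_iff forall_2 vmult_nth_2 v_def)
  ultimately show "u \<in> int_lattice M" unfolding int_lattice_def by blast
qed

lemma lattice_comb:
  fixes j k :: int
  assumes "L \<in> X2" "u \<in> L" "v \<in> L"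
  shows "of_int j *\<^sub>R u + of_int k *\<^sub>R v \<in> L"
proof -
  obtain M where L: "L = int_lattice M" using assms(1) by (auto simp: X2_iff)
  obtain m n m' n' :: int where
    "u$1 = m * M$1$1 + n * M$2$1" "u$2 = m * M$1$2 + n * M$2$2"
    "v$1 = m' * M$1$1 + n' * M$2$1" "v$2 = m' * M$1$2 + n' * M$2$2"
    using assms(2,3) unfolding L int_lattice_iff by blast
  then show ?thesis
    unfolding L int_lattice_iff
    by (intro exI[of _ "j * m + k * m'"] exI[of _ "j * n + k * n'"]) (simp add: algebra_simps)
qed

lemma lattice_add: "L \<in> X2 \<Longrightarrow> u \<in> L \<Longrightarrow> v \<in> L \<Longrightarrow> u + v \<in> L"
  using lattice_comb[of L u v 1 1] by simp

lemma lattice_diff: "L \<in> X2 \<Longrightarrow> u \<in> L \<Longrightarrow> v \<in> L \<Longrightarrow> u - v \<in> L"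
  using lattice_comb[of L u v 1 "-1"] by simp

text \<open>Cramer's rule bounds the integer coordinates of a lattice point in the box.\<close>

lemma finite_lattice_box:
  assumes "L \<in> X2"
  shows "finite {u \<in> L. \<bar>u$1\<bar> \<le> c \<and> \<bar>u$2\<bar> \<le> d}"
proof -
  obtain M where M: "M \<in> SL2R" "L = int_lattice M" using assms by (auto simp: X2_iff)
  obtain p q r s where M_eq: "M = mat2 p q r s" by (metis mat2_eta)
  have det: "p * s - q * r = 1" using M by (simp add: M_eq SL2R_det)
  have sum4: "x \<le> a + b + e + f"
    if "x \<le> y + z" "y \<le> a" "z \<le> b" "0 \<le> a"  "0 \<le> b" "0 \<le> e" "0 \<le> f" for x y z a b e f :: real
    using that by linarith
  define K where "K = c * \<bar>s\<bar> + d * \<bar>r\<bar> + c * \<bar>q\<bar> + d * \<bar>p\<bar>"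
  let ?I = "{x :: real. x \<in> \<int> \<and> \<bar>x\<bar> \<le> K}"
  have "{u \<in> L. \<bar>u$1\<bar> \<le> c \<and> \<bar>u$2\<bar> \<le> d} \<subseteq> (\<lambda>(m, n). vector [m * p + n * r, m * q + n * s]) ` (?I \<times> ?I)"
  proof
    fix u assume "u \<in> {u \<in> L. \<bar>u$1\<bar> \<le> c \<and> \<bar>u$2\<bar> \<le> d}"
    then have u: "u \<in> L" "\<bar>u$1\<bar> \<le> c" "\<bar>u$2\<bar> \<le> d" by auto
    then obtain m n :: int where mn: "u$1 = m * p + n * r" "u$2 = m * q + n * s"
      by (auto simp: M(2) int_lattice_iff M_eq)
    have "m = u$1 * s - u$2 * r" "n = u$2 * p - u$1 * q"
      unfolding mn using arg_cong[OF det, of "\<lambda>d. m * d"] arg_cong[OF det, of "\<lambda>d. n * d"]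
      by (simp_all add: algebra_simps)
    then have "\<bar>of_int m :: real\<bar> \<le> \<bar>u$1 * s\<bar> + \<bar>u$2 * r\<bar>" "\<bar>of_int n :: real\<bar> \<le> \<bar>u$2 * p\<bar> + \<bar>u$1 * q\<bar>"
      by (simp_all only: abs_triangle_ineq4)
    moreover have "\<bar>u$1 * s\<bar> \<le> c * \<bar>s\<bar>" "\<bar>u$2 * r\<bar> \<le> d * \<bar>r\<bar>" "\<bar>u$2 * p\<bar> \<le> d * \<bar>p\<bar>" "\<bar>u$1 * q\<bar> \<le> c * \<bar>q\<bar>"
      using u(2,3) unfolding abs_mult by (intro mult_right_mono; simp)+
    moreover have "0 \<le> c * \<bar>s\<bar>" "0 \<le> d * \<bar>r\<bar>" "0 \<le> d * \<bar>p\<bar>" "0 \<le> c * \<bar>q\<bar>"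
      using u(2,3) by (intro mult_nonneg_nonneg; simp)+
    ultimately have "\<bar>of_int m :: real\<bar> \<le> c * \<bar>s\<bar> + d * \<bar>r\<bar> + d * \<bar>p\<bar> + c * \<bar>q\<bar>"
      "\<bar>of_int n :: real\<bar> \<le> d * \<bar>p\<bar> + c * \<bar>q\<bar> + c * \<bar>s\<bar> + d * \<bar>r\<bar>"
      by (blast intro: sum4)+
    then have "\<bar>of_int m :: real\<bar> \<le> K" "\<bar>of_int n :: real\<bar> \<le> K"
      unfolding K_def by (simp_all only: ac_simps)
    moreover have "u = vector [m * p + n * r, m * q + n * s]"
      using mn by (simp add: vec_eq_iff forall_2)
    ultimately show "u \<in> (\<lambda>(m, n). vector [m * p + n * r, m * q + n * s]) ` (?I \<times> ?I)"
      by (intro image_eqI[of _ _ "(of_int m, of_int n)"]) auto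
  qed
  moreover have "finite ?I" by (rule finite_abs_int_segment)
  ultimately show ?thesis by (meson finite_SigmaI finite_imageI finite_subset)
qed

text \<open>Lattices with a nonzero point on a coordinate axis have measure zero. For all others leftmost points
  of half-strips exist and are unique, which is what the canonical basis is made of.\<close>

definition generic :: "(real^2) set \<Rightarrow> bool" where
  "generic L \<longleftrightarrow> (\<forall>u\<in>L. u \<noteq> 0 \<longrightarrow> u$1 \<noteq> 0 \<and> u$2 \<noteq> 0)"

text \<open>Dirichlet's approximation theorem, applied to the quotient of the second coordinates of two basis
  vectors, gives an integer combination whose height is at most one.\<close>

lemma strip_point:
  assumes "L \<in> X2" "generic L"
  obtains v where "v \<in> L" "0 < v$1" "v$2 \<noteq> 0" "\<bar>v$2\<bar> \<le> 1"
proof -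
  obtain M where M: "M \<in> SL2R" "L = int_lattice M" using assms by (auto simp: X2_iff)
  obtain p q r s where M_eq: "M = mat2 p q r s" by (metis mat2_eta)
  have det: "p * s - q * r = 1" using M by (simp add: M_eq SL2R_det)
  have rows: "M$i \<in> L" "M$i \<noteq> 0" for i
  proof -
    show "M$i \<in> L" using row_in_int_lattice M by blast
    show "M$i \<noteq> 0" using det exhaust_2[of i] by (auto simp: M_eq vec_eq_iff forall_2 mat2_def)
  qed
  have "s \<noteq> 0" using rows[of 2] assms(2) unfolding generic_def M_eq by (metis mat2_nth(4))
  define N where "N = nat \<lceil>\<bar>s\<bar>\<rceil> + 1"
  have N: "N > 0" "\<bar>s\<bar> \<le> real N" unfolding N_def by linarith+
  obtain h k :: int where hk: "0 < k" "\<bar>of_int k * (q / s) - of_int h\<bar> < 1 / real N"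
    using Dirichlet_approx[OF N(1), of "q / s"] by metis
  define u where "u = of_int k *\<^sub>R M$1 + of_int (- h) *\<^sub>R M$2"
  have u: "u \<in> L" unfolding u_def by (rule lattice_comb[OF assms(1) rows(1) rows(1)])
  have u2: "u$2 = k * q - h * s" and u1: "u$1 = k * p - h * r" by (simp_all add: u_def M_eq)
  have "\<bar>u$2\<bar> = \<bar>of_int k * (q / s) - of_int h\<bar> * \<bar>s\<bar>"
  proof -
    have "u$2 = (of_int k * (q / s) - of_int h) * s"
      unfolding u2 using \<open>s \<noteq> 0\<close> by (simp add: field_simps)
    then show ?thesis by (simp only: abs_mult)
  qed
  also have "\<dots> \<le> 1 / real N * real N"
    using hk N by (intro mult_mono) auto
  finally have le: "\<bar>u$2\<bar> \<le> 1" using N by simp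
  have "u \<noteq> 0"
  proof
    assume "u = 0"
    then have "k * p - h * r = 0" "k * q - h * s = 0" using u1 u2 by simp_all
    then have "k * (p * s - q * r) = 0" by algebra
    then show False using det hk by simp
  qed
  then have nz: "u$1 \<noteq> 0" "u$2 \<noteq> 0" using assms(2) u by (auto simp: generic_def)
  show ?thesis
  proof (cases "u$1 > 0")
    case True
    then show ?thesis using that[of u] u nz le by simp
  next
    case False
    have "- u \<in> L" using lattice_comb[OF assms(1) u u, of "-1" 0] by simp
    then show ?thesis using that[of "- u"] False nz le by simp
  qed
qed

text \<open>Take \<open>z\<close> on that side of the line \<open>\<real> v\<close> which contains the positive horizontal axis direction, and correct
  the height of a large multiple \<open>j z\<close> by a multiple of \<open>v\<close> so that it has the sign opposite to \<open>v\<close>. The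
  horizontal coordinate that remains is \<open>j\<close> times a positive number, up to a bounded error.\<close>

lemma opposite_point:
  assumes L: "L \<in> X2" and v: "v \<in> L" "0 < v$1" "v$2 \<noteq> 0"
  obtains z where "z \<in> L" "0 < z$1" "-1 \<le> z$2 / v$2" "z$2 / v$2 < 0"
proof -
  obtain M where M: "M \<in> SL2R" "L = int_lattice M" using L by (auto simp: X2_iff)
  obtain p q r s where M_eq: "M = mat2 p q r s" by (metis mat2_eta)
  have det: "p * s - q * r = 1" using M by (simp add: M_eq SL2R_det)
  have rows: "M$i \<in> L" for i using row_in_int_lattice M by blast
  define f where "f z = z$1 - z$2 / v$2 * v$1" for z :: "real^2"
  have "\<exists>z\<in>L. f z \<noteq> 0"
  proof (rule ccontr)
    assume "\<not> ?thesis"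
    then have "f (M$1) = 0" "f (M$2) = 0" using rows by auto
    then have "p * v$2 = q * v$1" "r * v$2 = s * v$1"
      using v by (simp_all add: f_def M_eq field_simps)
    then have "v$1 * (p * s - q * r) = 0" by algebra
    then show False using det v by simp
  qed
  then obtain z0 where z0: "z0 \<in> L" "f z0 \<noteq> 0" by blast
  define z where "z = (if f z0 > 0 then z0 else - z0)"
  have "- z0 \<in> L" using lattice_comb[OF L z0(1) z0(1), of "-1" 0] by simp
  then have z: "z \<in> L" "f z > 0" using z0 by (auto simp: z_def f_def)
  obtain j :: nat where j: "v$1 < real j * f z" using z(2) reals_Archimedean3 by blast
  define k where "k = \<lceil>- (real j * (z$2 / v$2))\<rceil> - 1"
  define y where "y = of_int (int j) *\<^sub>R z + of_int k *\<^sub>R v"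
  have "y \<in> L" unfolding y_def by (rule lattice_comb[OF L z(1) v(1)])
  have k: "-1 \<le> real_of_int k + real j * (z$2 / v$2)" "real_of_int k + real j * (z$2 / v$2) < 0"
    unfolding k_def by linarith+
  have y2: "y$2 / v$2 = real_of_int k + real j * (z$2 / v$2)"
    using v by (simp add: y_def field_simps)
  have "(real_of_int k + real j * (z$2 / v$2)) * v$1 \<ge> -1 * v$1"
    using k v by (intro mult_right_mono) auto
  moreover have "y$1 = real j * f z + (real_of_int k + real j * (z$2 / v$2)) * v$1"
    by (simp add: y_def f_def algebra_simps)
  ultimately have "0 < y$1" using j by linarith
  then show ?thesis using that[of y] \<open>y \<in> L\<close> k y2 by simp
qed

text \<open>A lattice has only finitely many points in a bounded box.\<close>

lemma leftmost_point:
  assumes "L \<in> X2" "u \<in> L" "0 < u$1" "P (u$2)" "\<And>y. P y \<Longrightarrow> \<bar>y\<bar> \<le> 1"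
  obtains v where "v \<in> L" "0 < v$1" "P (v$2)"
    "\<And>z. z \<in> L \<Longrightarrow> 0 < z$1 \<Longrightarrow> P (z$2) \<Longrightarrow> v$1 \<le> z$1"
proof -
  let ?S = "{z \<in> L. 0 < z$1 \<and> z$1 \<le> u$1 \<and> P (z$2)}"
  have "finite ?S"
    by (rule finite_subset[OF _ finite_lattice_box[OF assms(1), of "u$1" 1]]) (use assms(5) in auto)
  moreover have "u \<in> ?S" using assms by simp
  ultimately obtain v where "v \<in> ?S" "\<And>z. z \<in> ?S \<Longrightarrow> v$1 \<le> z$1"
    using arg_min_if_finite[of ?S "\<lambda>z. z$1"] by (metis (no_types, lifting) empty_iff linorder_not_less)
  then show ?thesis using that[of v] by (smt (verit) mem_Collect_eq)
qed

text \<open>Let \<open>v\<close> and \<open>w\<close> be the points of the lattice with the least positive horizontal coordinate among those of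
  height in \<open>(0, 1]\<close> and in \<open>[-1, 0)\<close>. If their heights differed by at most one, then \<open>v - w\<close> or \<open>w - v\<close> would
  be a competitor further to the left. Any lattice point is congruent modulo \<open>v\<close> and \<open>w\<close> to a point \<open>e\<close> of the
  half-open parallelogram that they span; if \<open>e\<close> were not \<open>0\<close>, minimality of \<open>v\<close> or \<open>w\<close>, applied to \<open>e\<close> and
  then to \<open>e - v\<close> or \<open>e - w\<close>, would push \<open>e\<close> out of the parallelogram. So \<open>v\<close> and \<open>w\<close> form a basis.\<close>

lemma cell_basis_exists:
  assumes L: "L \<in> X2" "generic L"
  obtains M where "M \<in> bases L" "M \<in> cell"
proof -
  obtain x where x: "x \<in> L" "0 < x$1" "x$2 \<noteq> 0" "\<bar>x$2\<bar> \<le> 1"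
    using strip_point[OF L] by blast
  obtain x' where x': "x' \<in> L" "0 < x'$1" "-1 \<le> x'$2 / x$2" "x'$2 / x$2 < 0"
    using opposite_point[OF L(1) x(1-3)] by blast
  have x'2: "x'$2 * x$2 < 0" "\<bar>x'$2\<bar> \<le> 1"
  proof -
    show "x'$2 * x$2 < 0" using x'(4) by (simp add: divide_less_0_iff mult_less_0_iff)
    have "\<bar>x'$2 / x$2\<bar> \<le> 1" using x' by linarith
    then show "\<bar>x'$2\<bar> \<le> 1" using x by (simp add: abs_divide divide_le_eq)
  qed
  have "\<exists>u\<in>L. 0 < u$1 \<and> (0 < u$2 \<and> u$2 \<le> 1)" "\<exists>u\<in>L. 0 < u$1 \<and> (-1 \<le> u$2 \<and> u$2 < 0)"
    using x x'(1,2) x'2 by (cases "x$2 > 0"; fastforce simp: mult_less_0_iff)+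
  then obtain u u' where u: "u \<in> L" "0 < u$1" "0 < u$2 \<and> u$2 \<le> 1"
    and u': "u' \<in> L" "0 < u'$1" "-1 \<le> u'$2 \<and> u'$2 < 0" by blast
  obtain v where v: "v \<in> L" "0 < v$1" "0 < v$2 \<and> v$2 \<le> 1"
    and minv: "\<And>z. z \<in> L \<Longrightarrow> 0 < z$1 \<Longrightarrow> 0 < z$2 \<and> z$2 \<le> 1 \<Longrightarrow> v$1 \<le> z$1"
    using leftmost_point[where P="\<lambda>y. 0 < y \<and> y \<le> 1", OF L(1) u] by auto
  obtain w where w: "w \<in> L" "0 < w$1" "-1 \<le> w$2 \<and> w$2 < 0"
    and minw: "\<And>z. z \<in> L \<Longrightarrow> 0 < z$1 \<Longrightarrow> -1 \<le> z$2 \<and> z$2 < 0 \<Longrightarrow> w$1 \<le> z$1"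
    using leftmost_point[where P="\<lambda>y. -1 \<le> y \<and> y < 0", OF L(1) u'] by auto
  have gen: "z$1 \<noteq> 0" "z$2 \<noteq> 0" if "z \<in> L" "z \<noteq> 0" for z
    using L(2) that by (auto simp: generic_def)
  have sum: "1 < v$2 - w$2"
  proof (rule ccontr)
    assume "\<not> ?thesis"
    then have le: "v$2 - w$2 \<le> 1" by simp
    have d: "v - w \<in> L" "w - v \<in> L" using v w L by (auto intro: lattice_diff)
    have "v - w \<noteq> 0" using v w by (auto simp: vec_eq_iff forall_2)
    then have "(v - w)$1 \<noteq> 0" using gen d by blast
    then show False
      using minv[OF d(1)] minw[OF d(2)] v w le by (cases "v$1 > w$1") auto
  qed
  define \<Delta> where "\<Delta> = v$2 * w$1 - v$1 * w$2"
  have "v$2 * w$1 > 0" "v$1 * w$2 < 0" using v w by (auto intro: mult_pos_neg)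
  then have \<Delta>: "\<Delta> > 0" by (simp add: \<Delta>_def)
  have comb: "\<exists>(m::int) (n::int). z = of_int m *\<^sub>R w + of_int n *\<^sub>R v" if z: "z \<in> L" for z
  proof -
    define x where "x = (z$2 * w$1 - z$1 * w$2) / \<Delta>"
    define y where "y = (z$1 * v$2 - z$2 * v$1) / \<Delta>"
    have xy: "z$1 = x * v$1 + y * w$1" "z$2 = x * v$2 + y * w$2"
    proof -
      have "\<Delta> * z$1 = (\<Delta> * x) * v$1 + (\<Delta> * y) * w$1" "\<Delta> * z$2 = (\<Delta> * x) * v$2 + (\<Delta> * y) * w$2"
        using \<Delta> by (simp_all add: x_def y_def) (simp_all add: \<Delta>_def algebra_simps)
      then have "\<Delta> * z$1 = \<Delta> * (x * v$1 + y * w$1)" "\<Delta> * z$2 = \<Delta> * (x * v$2 + y * w$2)"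
        by (simp_all add: algebra_simps)
      then show "z$1 = x * v$1 + y * w$1" "z$2 = x * v$2 + y * w$2" using \<Delta> by simp_all
    qed
    define e where "e = z - (of_int \<lfloor>y\<rfloor> *\<^sub>R w + of_int \<lfloor>x\<rfloor> *\<^sub>R v)"
    have e: "e \<in> L" unfolding e_def
      by (intro lattice_diff lattice_comb L z v w)
    define f g where "f = frac x" and "g = frac y"
    have fg: "0 \<le> f" "f < 1" "0 \<le> g" "g < 1" by (auto simp: f_def g_def frac_lt_1)
    have e12: "e$1 = f * v$1 + g * w$1" "e$2 = f * v$2 + g * w$2"
      by (simp_all add: e_def xy f_def g_def frac_def algebra_simps)
    have b: "0 \<le> f * v$1" "f * v$1 \<le> v$1" "0 \<le> g * w$1" "g * w$1 \<le> w$1"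
       "0 \<le> f * v$2" "f * v$2 \<le> v$2" "g * w$2 \<le> 0" "w$2 \<le> g * w$2"
      using fg v w by (auto simp: mult_le_cancel_right1 mult_nonneg_nonpos mult_le_cancel_right2)
    have strict: "f * v$1 < v$1" "g * w$1 < w$1" "f * v$2 < v$2" "w$2 < g * w$2"
      using fg v w by (auto simp: mult_less_cancel_right1 mult_less_cancel_right2)
    have "e = 0"
    proof (rule ccontr)
      assume "e \<noteq> 0"
      then have nz: "e$1 \<noteq> 0" "e$2 \<noteq> 0" using gen e by auto
      have "e$1 > 0" using nz e12 b by linarith
      show False
      proof (cases "e$2 > 0")
        case True
        have "v$1 \<le> e$1" using minv[OF e \<open>e$1 > 0\<close>] True e12 b v by linarith
        have d: "e - v \<in> L" using e v L by (auto intro: lattice_diff)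
        have d2: "(e - v)$2 < 0" "-1 \<le> (e - v)$2"
          unfolding vector_minus_component using True e12 b strict v by linarith+
        then have "e - v \<noteq> 0" by auto
        then have "(e - v)$1 > 0" using gen[OF d] \<open>v$1 \<le> e$1\<close> by auto
        then have "w$1 \<le> (e - v)$1" using minw[OF d] d2 by blast
        then show False unfolding vector_minus_component using e12 strict by linarith
      next
        case False
        then have neg: "e$2 < 0" using nz by simp
        have "w$1 \<le> e$1" using minw[OF e \<open>e$1 > 0\<close>] neg e12 b w by linarith
        have d: "e - w \<in> L" using e w L by (auto intro: lattice_diff)
        have d2: "(e - w)$2 > 0" "(e - w)$2 \<le> 1"
          unfolding vector_minus_component using neg e12 b strict w v by linarith+
        then have "e - w \<noteq> 0" by auto
        then have "(e - w)$1 > 0" using gen[OF d] \<open>w$1 \<le> e$1\<close> by auto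
        then have "v$1 \<le> (e - w)$1" using minv[OF d] d2 by blast
        then show False unfolding vector_minus_component using e12 strict by linarith
      qed
    qed
    then show ?thesis unfolding e_def by (metis eq_iff_diff_eq_0)
  qed
  define N where "N = mat2 (w$1) (w$2) (v$1) (v$2)"
  obtain M where M: "M \<in> SL2R" "L = int_lattice M" using L by (auto simp: X2_iff)
  have L_N: "L = int_lattice N"
  proof (intro equalityI subsetI)
    fix z assume "z \<in> L"
    then obtain m n :: int where "z = of_int m *\<^sub>R w + of_int n *\<^sub>R v" using comb by blast
    then show "z \<in> int_lattice N"
      unfolding int_lattice_iff by (intro exI[of _ m] exI[of _ n]) (simp add: N_def)
  next
    fix z assume "z \<in> int_lattice N"
    then obtain m n :: int where "z$1 = m * w$1 + n * v$1" "z$2 = m * w$2 + n * v$2"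
      by (auto simp: int_lattice_iff N_def)
    then have "z = of_int m *\<^sub>R w + of_int n *\<^sub>R v" by (simp add: vec_eq_iff forall_2)
    then show "z \<in> L" using lattice_comb[OF L(1) w(1) v(1)] by simp
  qed
  have "N \<in> SL2R"
  proof -
    obtain a b c d :: int where 
      ab: "w$1 = a * M$1$1 + b * M$2$1" "w$2 = a * M$1$2 + b * M$2$2" and
      cd: "v$1 = c * M$1$1 + d * M$2$1" "v$2 = c * M$1$2 + d * M$2$2"
      using v(1) w(1) unfolding M(2) int_lattice_iff by blast
    have rows: "M$1 \<in> int_lattice N" "M$2 \<in> int_lattice N"
      using row_in_int_lattice[of M] L_N M(2) by auto
    obtain a' b' c' d' :: int where 
      ab': "M$1$1 = a' * w$1 + b' * v$1" "M$1$2 = a' * w$2 + b' * v$2" and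
      cd': "M$2$1 = c' * w$1 + d' * v$1" "M$2$2 = c' * w$2 + d' * v$2"
      using rows unfolding int_lattice_iff by (auto simp: N_def)
    have detM: "M$1$1 * M$2$2 - M$1$2 * M$2$1 = 1" using M by (simp add: SL2R_det)
    have D: "\<Delta> = real_of_int (a * d - b * c) * 1"
      unfolding detM[symmetric] \<Delta>_def ab cd by (simp add: algebra_simps)
    have "1 = real_of_int (a' * d' - b' * c') * \<Delta>"
      unfolding detM[symmetric] \<Delta>_def ab' cd' by (simp add: algebra_simps)
    then have "real_of_int ((a' * d' - b' * c') * (a * d - b * c)) = 1"
      using D by (simp only: of_int_mult mult_1_right)
    then have "(a' * d' - b' * c') * (a * d - b * c) = 1" by linarith
    moreover have "a * d - b * c > 0" using D \<Delta> by (metis mult_1_right of_int_0_less_iff)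
    ultimately have "a * d - b * c = 1"
      by (metis mult.commute pos_zmult_eq_1_iff)
    then have "\<Delta> = 1" using D by simp
    then show ?thesis by (simp add: SL2R_det N_def \<Delta>_def algebra_simps)
  qed
  then have "N \<in> bases L" using L_N by (simp add: bases_def)
  then show ?thesis
    using v w sum by (intro that[of N]) (auto simp: N_def cell_def)
qed

section \<open>Empty boxes and the canonical basis\<close>

text \<open>Conversely, the rows of a matrix of the cell are the leftmost points of the lattice that they generate.
  The signs of the horizontal coordinate and of the height force one of the integer coefficients \<open>m\<close>, \<open>n\<close> to be
  positive, and then the other one is nonnegative, since otherwise the height would be at least \<open>\<alpha> + \<beta> > 1\<close> in
  absolute value.\<close>

lemma cell_row_extremal:
  fixes m n :: int
  assumes M: "M \<in> cell" and x: "0 < m * M$1$1 + n * M$2$1"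
  shows "0 < m * M$1$2 + n * M$2$2 \<Longrightarrow> m * M$1$2 + n * M$2$2 \<le> 1 \<Longrightarrow>
      M$2$1 < m * M$1$1 + n * M$2$1 \<or> m = 0 \<and> n = 1"
    and "m * M$1$2 + n * M$2$2 < 0 \<Longrightarrow> -1 \<le> m * M$1$2 + n * M$2$2 \<Longrightarrow>
      M$1$1 < m * M$1$1 + n * M$2$1 \<or> m = 1 \<and> n = 0"
proof -
  obtain b \<beta> a \<alpha> where M_eq: "M = mat2 b (- \<beta>) a \<alpha>" by (metis mat2_eta minus_minus)
  have pos: "0 < a" "0 < b" "0 < \<alpha>" "0 < \<beta>" "1 < \<alpha> + \<beta>"
    using M by (auto simp: M_eq cell_def)
  have ge: "c \<le> of_int k * c" if "1 \<le> k" "0 < c" for k :: int and c :: real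
    using that by (simp add: mult_le_cancel_right1)
  have le: "of_int k * c \<le> 0" if "k \<le> 0" "0 < c" for k :: int and c :: real
    using that by (simp add: mult_nonpos_nonneg)
  have x: "0 < m * b + n * a" using x by (simp add: M_eq)
  show "M$2$1 < m * M$1$1 + n * M$2$1 \<or> m = 0 \<and> n = 1"
    if y: "0 < m * M$1$2 + n * M$2$2" "m * M$1$2 + n * M$2$2 \<le> 1"
  proof -
    have y: "0 < n * \<alpha> - m * \<beta>" "n * \<alpha> - m * \<beta> \<le> 1" using y by (simp_all add: M_eq)
    have "n \<ge> 1"
    proof (rule ccontr)
      assume "\<not> n \<ge> 1"
      then have "n * \<alpha> \<le> 0" "n * a \<le> 0" using le pos by auto
      then have "m * \<beta> < 0" "0 < m * b" using y x by linarith+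
      then show False using pos by (simp add: mult_less_0_iff zero_less_mult_iff)
    qed
    have "m \<ge> 0"
    proof (rule ccontr)
      assume "\<not> m \<ge> 0"
      then have "\<beta> \<le> of_int (- m) * \<beta>" by (intro ge pos) simp
      moreover have "\<alpha> \<le> n * \<alpha>" using \<open>n \<ge> 1\<close> pos by (intro ge)
      ultimately show False using y pos by simp
    qed
    show ?thesis
    proof (cases "m = 0")
      case True
      then show ?thesis
        using \<open>n \<ge> 1\<close> pos by (cases "n = 1") (auto simp: M_eq mult_less_cancel_right1)
    next
      case False
      then have "b \<le> m * b" using \<open>m \<ge> 0\<close> by (intro ge pos) simp
      moreover have "a \<le> n * a" using \<open>n \<ge> 1\<close> by (intro ge pos)
      ultimately have "a < m * b + n * a" using pos by linarith
      then show ?thesis by (simp add: M_eq)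
    qed
  qed
  show "M$1$1 < m * M$1$1 + n * M$2$1 \<or> m = 1 \<and> n = 0"
    if y: "m * M$1$2 + n * M$2$2 < 0" "-1 \<le> m * M$1$2 + n * M$2$2"
  proof -
    have y: "n * \<alpha> - m * \<beta> < 0" "-1 \<le> n * \<alpha> - m * \<beta>" using y by (simp_all add: M_eq)
    have "m \<ge> 1"
    proof (rule ccontr)
      assume "\<not> m \<ge> 1"
      then have "m * \<beta> \<le> 0" "m * b \<le> 0" using le pos by auto
      then have "n * \<alpha> < 0" "0 < n * a" using y x by linarith+
      then show False using pos by (simp add: mult_less_0_iff zero_less_mult_iff)
    qed
    have "n \<ge> 0"
    proof (rule ccontr)
      assume "\<not> n \<ge> 0"
      then have "\<alpha> \<le> of_int (- n) * \<alpha>" by (intro ge pos) simp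
      moreover have "\<beta> \<le> m * \<beta>" using \<open>m \<ge> 1\<close> pos by (intro ge)
      ultimately show False using y pos by simp
    qed
    show ?thesis
    proof (cases "n = 0")
      case True
      then show ?thesis
        using \<open>m \<ge> 1\<close> pos by (cases "m = 1") (auto simp: M_eq mult_less_cancel_right1)
    next
      case False
      then have "a \<le> n * a" using \<open>n \<ge> 0\<close> by (intro ge pos) simp
      moreover have "b \<le> m * b" using \<open>m \<ge> 1\<close> by (intro ge pos)
      ultimately have "b < m * b + n * a" using pos by linarith
      then show ?thesis by (simp add: M_eq)
    qed
  qed
qed

lemma cell_basis_unique:
  assumes "M \<in> cell \<inter> bases L" "N \<in> cell \<inter> bases L"
  shows "M = N"
proof -
  have comb: "\<exists>(m::int) (n::int). (A$i)$1 = m * B$1$1 + n * B$2$1 \<and> (A$i)$2 = m * B$1$2 + n * B$2$2"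
    if "A \<in> bases L" "B \<in> bases L" for A B :: "real^2^2" and i
  proof -
    have "A$i \<in> int_lattice B"
      using row_in_int_lattice[of A i] that by (simp add: bases_def)
    then show ?thesis by (simp add: int_lattice_iff)
  qed
  have less: "B$2$1 < A$2$1 \<or> A$2 = B$2" "B$1$1 < A$1$1 \<or> A$1 = B$1"
    if A: "A \<in> cell" "A \<in> bases L" and B: "B \<in> cell" "B \<in> bases L" for A B
  proof -
    obtain m n :: int where 2: "A$2$1 = m * B$1$1 + n * B$2$1" "A$2$2 = m * B$1$2 + n * B$2$2"
      using comb[OF A(2) B(2)] by blast
    have "0 < A$2$1" "0 < A$2$2" "A$2$2 \<le> 1" using A by (auto simp: cell_def)
    then have "B$2$1 < A$2$1 \<or> m = 0 \<and> n = 1"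
      unfolding 2 by (intro cell_row_extremal(1)[OF B(1)])
    then show "B$2$1 < A$2$1 \<or> A$2 = B$2"
      using 2 by (auto simp: vec_eq_iff forall_2)
    obtain m n :: int where 1: "A$1$1 = m * B$1$1 + n * B$2$1" "A$1$2 = m * B$1$2 + n * B$2$2"
      using comb[OF A(2) B(2)] by blast
    have "0 < A$1$1" "A$1$2 < 0" "-1 \<le> A$1$2" using A by (auto simp: cell_def)
    then have "B$1$1 < A$1$1 \<or> m = 1 \<and> n = 0"
      unfolding 1 by (intro cell_row_extremal(2)[OF B(1)])
    then show "B$1$1 < A$1$1 \<or> A$1 = B$1"
      using 1 by (auto simp: vec_eq_iff forall_2)
  qed
  show ?thesis
    using less[of M N] less[of N M] assms by (auto simp: vec_eq_iff[of M N] forall_2)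
qed

text \<open>Equivalently, the translates by the lattice of a \<open>T\<close> by \<open>1\<close> box cover the plane.\<close>

definition box_covers :: "real \<Rightarrow> (real^2) set \<Rightarrow> bool" where
  "box_covers T L \<longleftrightarrow> (\<forall>z :: real^2. \<exists>u\<in>L. \<bar>z$1 - u$1\<bar> \<le> T/2 \<and> \<bar>z$2 - u$2\<bar> \<le> 1/2)"

text \<open>The open rectangle with sides \<open>(0, a + b)\<close> and \<open>(- \<beta>, \<alpha>)\<close> has the points \<open>0\<close>, \<open>v\<close>, \<open>v + w\<close>, \<open>w\<close> on its four
  sides and no lattice point inside: for a point \<open>m w + n v\<close> in it the vertical bounds make \<open>m\<close> and \<open>n\<close> both
  positive or both nonpositive, which contradicts the horizontal bounds. It is longer than \<open>T\<close> and higher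
  than \<open>1\<close>, so the closed box around its centre contains no lattice point either.\<close>

lemma wide_cell_not_covering:
  assumes M: "M \<in> cell" "M \<in> bases L" and wide: "T < M$1$1 + M$2$1"
  shows "\<not> box_covers T L"
proof
  assume cov: "box_covers T L"
  define z :: "real^2" where "z = vector [(M$1$1 + M$2$1) / 2, (M$2$2 + M$1$2) / 2]"
  obtain u where u: "u \<in> L" "\<bar>z$1 - u$1\<bar> \<le> T/2" "\<bar>z$2 - u$2\<bar> \<le> 1/2"
    using cov unfolding box_covers_def by blast
  have "L = int_lattice M" using M by (simp add: bases_def)
  then obtain m n :: int where mn: "u$1 = m * M$1$1 + n * M$2$1" "u$2 = m * M$1$2 + n * M$2$2"
    using u(1) by (auto simp: int_lattice_iff)
  obtain b \<beta> a \<alpha> where M_eq: "M = mat2 b (- \<beta>) a \<alpha>" by (metis mat2_eta minus_minus)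
  have pos: "0 < a" "0 < b" "0 < \<alpha>" "0 < \<beta>" "1 < \<alpha> + \<beta>"
    using M by (auto simp: M_eq cell_def)
  have z: "z$1 = (b + a) / 2" "z$2 = (\<alpha> - \<beta>) / 2" by (simp_all add: z_def M_eq)
  have u12: "u$1 = m * b + n * a" "u$2 = n * \<alpha> - m * \<beta>" using mn by (simp_all add: M_eq)
  have wide': "T < b + a" using wide by (simp add: M_eq)
  have strict: "s < y" "y < t" if "\<bar>(s + t) / 2 - y\<bar> \<le> h / 2" "h < t - s" for s t y h :: real
    using that by (auto simp: abs_le_iff field_simps)
  have x: "0 < m * b + n * a" "m * b + n * a < b + a"
    using strict[of 0 "b + a" "m * b + n * a" T] u(2) wide' by (simp_all only: z u12 add_0_left diff_0_right simp_thms)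
  have y: "- \<beta> < n * \<alpha> - m * \<beta>" "n * \<alpha> - m * \<beta> < \<alpha>"
    using strict[of "- \<beta>" \<alpha> "n * \<alpha> - m * \<beta>" 1] u(3) pos(5)
    by (simp_all only: z u12 diff_minus_eq_add uminus_add_conv_diff add_uminus_conv_diff simp_thms add.commute[of "- \<beta>"])
  have ge: "c \<le> of_int k * c" if "1 \<le> k" "0 < c" for k :: int and c :: real
    using that by (simp add: mult_le_cancel_right1)
  have le: "of_int k * c \<le> 0" if "k \<le> 0" "0 < c" for k :: int and c :: real
    using that by (simp add: mult_nonpos_nonneg)
  show False
  proof (cases "m \<ge> 1")
    case True
    have "n \<ge> 1"
    proof (rule ccontr)
      assume "\<not> n \<ge> 1"
      then have "n * \<alpha> \<le> 0" using le pos by auto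
      then show False using ge[OF True pos(4)] y by linarith
    qed
    then show False using ge[OF True pos(2)] ge[OF _ pos(1)] x by force
  next
    case False
    have "n \<le> 0"
    proof (rule ccontr)
      assume "\<not> n \<le> 0"
      then have "\<alpha> \<le> n * \<alpha>" by (intro ge pos) simp
      moreover have "m * \<beta> \<le> 0" using False pos by (intro le) auto
      ultimately show False using y by linarith
    qed
    then have "n * a \<le> 0" "m * b \<le> 0" using False pos le by auto
    then show False using x by linarith
  qed
qed

text \<open>This is the three-gap principle. From a lattice point in a horizontal strip of height one, one of the
  steps \<open>v\<close>, \<open>w\<close>, \<open>v + w\<close> leads to another lattice point of the strip, because \<open>\<alpha>, \<beta> \<le> 1 < \<alpha> + \<beta>\<close>. All three go to
  the right by at most \<open>a + b\<close>, so the last point of the strip in front of a box of length \<open>T \<ge> a + b\<close> is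
  followed by a point in the box.\<close>

lemma narrow_cell_covering:
  assumes L: "L \<in> X2" and M: "M \<in> cell" "M \<in> bases L" and narrow: "M$1$1 + M$2$1 \<le> T"
  shows "box_covers T L"
  unfolding box_covers_def
proof
  fix z :: "real^2"
  define x0 y0 where "x0 = z$1 - T/2" and "y0 = z$2 - 1/2"
  obtain b \<beta> a \<alpha> where M_eq: "M = mat2 b (- \<beta>) a \<alpha>" by (metis mat2_eta minus_minus)
  have pos: "0 < a" "0 < b" "0 < \<alpha>" "0 < \<beta>" "1 < \<alpha> + \<beta>" "\<alpha> \<le> 1" "\<beta> \<le> 1"
    using M by (auto simp: M_eq cell_def)
  have T: "a + b \<le> T" using narrow by (simp add: M_eq)
  define v w where "v = M$2" and "w = M$1"
  have vw: "v$1 = a" "v$2 = \<alpha>" "w$1 = b" "w$2 = - \<beta>" by (simp_all add: v_def w_def M_eq)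
  have in_L: "v \<in> L" "w \<in> L"
    using row_in_int_lattice[of M] M by (auto simp: v_def w_def bases_def)
  define strip where "strip = {u \<in> L. y0 \<le> u$2 \<and> u$2 \<le> y0 + 1 \<and> u$1 < x0}"
  \<comment> \<open>A large negative multiple of \<open>w\<close>, brought back into the strip by a multiple of \<open>v\<close>, lies far to the left.\<close>
  obtain u0 where u0: "u0 \<in> strip"
  proof -
    define c where "c = b + \<beta> / \<alpha> * a"
    have "c > 0" using pos by (simp add: c_def add_pos_pos)
    obtain j :: nat where j: "\<bar>y0 / \<alpha>\<bar> * a + a - x0 < real j * c"
      using \<open>c > 0\<close> reals_Archimedean3 by blast
    define k where "k = \<lceil>(y0 - real j * \<beta>) / \<alpha>\<rceil>"
    define u where "u = of_int (- int j) *\<^sub>R w + of_int k *\<^sub>R v"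
    have "u \<in> L" unfolding u_def by (rule lattice_comb[OF L in_L(2,1)])
    have k: "(y0 - real j * \<beta>) / \<alpha> \<le> k" "k < (y0 - real j * \<beta>) / \<alpha> + 1"
      unfolding k_def by linarith+
    have k': "y0 - real j * \<beta> \<le> k * \<alpha>" "k * \<alpha> < y0 - real j * \<beta> + \<alpha>"
      using k pos by (simp_all add: field_simps)
    have "u$2 = real j * \<beta> + k * \<alpha>" by (simp add: u_def vw)
    then have "y0 \<le> u$2" "u$2 \<le> y0 + 1" using k' pos by simp_all
    moreover have "u$1 < x0"
    proof -
      have "k * a < ((y0 - real j * \<beta>) / \<alpha> + 1) * a" using k pos by (intro mult_strict_right_mono)
      also have "\<dots> = y0 / \<alpha> * a - real j * (\<beta> / \<alpha> * a) + a"
        by (simp add: field_simps diff_divide_distrib)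
      finally have "u$1 < y0 / \<alpha> * a + a - real j * c"
        by (simp add: u_def vw c_def algebra_simps)
      moreover have "y0 / \<alpha> * a \<le> \<bar>y0 / \<alpha>\<bar> * a" using pos by (intro mult_right_mono abs_ge_self) simp
      ultimately have "u$1 < \<bar>y0 / \<alpha>\<bar> * a + a - real j * c" by (rule less_le_trans[OF _ diff_right_mono[OF add_right_mono]])
      also have "\<dots> < x0" using j by (simp only: less_diff_eq diff_less_eq add.commute)
      finally show ?thesis .
    qed
    ultimately show ?thesis using that[of u] \<open>u \<in> L\<close> by (simp add: strip_def)
  qed
  let ?S = "{u \<in> strip. u0$1 \<le> u$1}"
  have "finite ?S"
    by (rule finite_subset[OF _ finite_lattice_box[OF L, of "\<bar>u0$1\<bar> + \<bar>x0\<bar>" "\<bar>y0\<bar> + 1"]])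
       (auto simp: strip_def)
  moreover have "u0 \<in> ?S" using u0 by simp
  ultimately obtain u where "u \<in> ?S" "\<And>u'. u' \<in> ?S \<Longrightarrow> u'$1 \<le> u$1"
    using arg_min_if_finite[of ?S "\<lambda>u. - (u$1)"]
    by (metis (no_types, lifting) empty_iff linorder_not_less neg_less_iff_less)
  then have u: "u \<in> strip" and max: "\<And>u'. u' \<in> strip \<Longrightarrow> u'$1 \<le> u$1"
    by (auto, smt (verit) mem_Collect_eq)
  \<comment> \<open>Its successor in the strip lies at most \<open>a + b\<close> further to the right.\<close>
  have uL: "u \<in> L" "y0 \<le> u$2" "u$2 \<le> y0 + 1" "u$1 < x0" using u by (auto simp: strip_def)
  obtain u' where u': "u' \<in> L" "y0 \<le> u'$2" "u'$2 \<le> y0 + 1" "u$1 < u'$1" "u'$1 \<le> u$1 + (a + b)"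
  proof (cases "u$2 + \<alpha> \<le> y0 + 1")
    case True
    then show ?thesis using that[of "u + v"] uL in_L L pos vw by (auto intro: lattice_add)
  next
    case up: False
    show ?thesis
    proof (cases "y0 \<le> u$2 - \<beta>")
      case True
      then show ?thesis using that[of "u + w"] uL in_L L pos vw by (auto intro: lattice_add)
    next
      case False
      have "u + v + w \<in> L" using uL in_L L by (auto intro: lattice_add)
      then show ?thesis using that[of "u + v + w"] uL pos vw up False by auto
    qed
  qed
  have "x0 \<le> u'$1"
  proof (rule ccontr)
    assume "\<not> x0 \<le> u'$1"
    then have "u' \<in> strip" using u' by (simp add: strip_def)
    then show False using max[of u'] u' by simp
  qed
  moreover have "u'$1 \<le> x0 + T" using u' T uL by linarith
  moreover have mid: "\<bar>c - y\<bar> \<le> h / 2" if "c - h / 2 \<le> y" "y \<le> c - h / 2 + h" for c y h :: real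
    using that by (intro abs_leI) (simp_all add: field_simps)
  ultimately show "\<exists>u\<in>L. \<bar>z$1 - u$1\<bar> \<le> T/2 \<and> \<bar>z$2 - u$2\<bar> \<le> 1/2"
    using u' mid[of "z$1" T "u'$1"] mid[of "z$2" 1 "u'$2"] unfolding x0_def y0_def by blast
qed

section \<open>The measure induced on bases\<close>

text \<open>Counting with a measure makes this countably additive in \<open>B\<close>.\<close>

definition bases_count :: "(real^2^2) set \<Rightarrow> (real^2) set \<Rightarrow> ennreal" where
  "bases_count B L = emeasure (count_space UNIV) (B \<inter> bases L)"

lemma bases_count_bounded_set:
  assumes "bounded B"
  obtains C where "\<And>L. bases_count B L = ennreal (real (card (B \<inter> bases L)))"
    "\<And>L. bases_count B L \<le> ennreal (real C)"
proof -
  obtain C where C: "\<And>L. finite (B \<inter> bases L)" "\<And>L. card (B \<inter> bases L) \<le> C"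
    using card_bases_bounded[OF assms] by blast
  have "bases_count B L = ennreal (real (card (B \<inter> bases L)))" for L
    using C(1) by (simp add: bases_count_def ennreal_of_nat_eq_real_of_nat)
  then show ?thesis using C(2) that[of C] by (simp add: ennreal_leI)
qed

lemma space_X2_borel: "space X2_borel = X2"
  unfolding X2_borel_def by (rule space_measure_of) auto

lemma open_in_X2_borel:
  assumes "U \<subseteq> X2" "openin (top_of_set SL2R) {M \<in> SL2R. int_lattice M \<in> U}"
  shows "U \<in> sets X2_borel"
  using assms unfolding X2_borel_def by (subst sets_measure_of) (auto intro!: sigma_sets.Basic)

lemma int_lattice_in_X2: "M \<in> SL2R \<Longrightarrow> int_lattice M \<in> X2"
  by (auto simp: X2_iff)

text \<open>If \<open>k\<close> bases of the lattice of \<open>M\<close> lie in an open set, the same \<open>k\<close> transition matrices produce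
  bases in that set for all lattices of matrices near \<open>M\<close>.\<close>

lemma many_bases_open:
  assumes "open U" "bounded U"
  shows "{L \<in> X2. k \<le> card (U \<inter> bases L)} \<in> sets X2_borel"
proof (rule open_in_X2_borel)
  let ?V = "\<Union>S\<in>{S. S \<subseteq> SL2Z \<and> finite S \<and> card S = k}. \<Inter>G\<in>S. {M. G ** M \<in> U}"
  have "k \<le> card (U \<inter> bases (int_lattice M)) \<longleftrightarrow> M \<in> ?V" if M: "M \<in> SL2R" for M
  proof -
    let ?A = "{G\<in>SL2Z. G ** M \<in> U}"
    have im: "U \<inter> bases (int_lattice M) = (\<lambda>G. G ** M) ` ?A"
      unfolding bases_int_lattice[OF M] by blast
    have inj: "inj_on (\<lambda>G. G ** M) ?A" by (rule inj_mult_right[OF M])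
    have fin: "finite (U \<inter> bases (int_lattice M))"
      using card_bases_bounded[OF assms(2)] by metis
    have finA: "finite ?A" using fin inj unfolding im by (simp add: finite_image_iff)
    have "card (U \<inter> bases (int_lattice M)) = card ?A"
      unfolding im by (rule card_image[OF inj])
    moreover have "k \<le> card ?A \<longleftrightarrow> (\<exists>S\<subseteq>?A. finite S \<and> card S = k)"
      using card_mono[OF finA] obtain_subset_with_card_n[of k ?A] by blast
    moreover have "(\<exists>S\<subseteq>?A. finite S \<and> card S = k) \<longleftrightarrow> M \<in> ?V"
      by (auto simp: subset_iff)
    ultimately show ?thesis by simp
  qed
  then have eq: "{M \<in> SL2R. int_lattice M \<in> {L \<in> X2. k \<le> card (U \<inter> bases L)}} = SL2R \<inter> ?V"
    by (auto simp: int_lattice_in_X2)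
  have "open {M. G ** M \<in> U}" for G :: "real^2^2"
  proof -
    have "continuous_on UNIV (\<lambda>M :: real^2^2. G ** M)" by (intro continuous_intros)
    then have "open ((\<lambda>M :: real^2^2. G ** M) -` U)" using assms(1) by (rule open_vimage[rotated])
    then show ?thesis by (simp add: vimage_def)
  qed
  then have "open ?V" by (intro open_UN ballI open_INT) auto
  then show "openin (top_of_set SL2R) {M \<in> SL2R. int_lattice M \<in> {L \<in> X2. k \<le> card (U \<inter> bases L)}}"
    unfolding eq by (rule openin_open_Int)
qed auto

lemma measurable_bases_count_open:
  assumes "open U" "bounded U"
  shows "bases_count U \<in> borel_measurable X2_borel"
proof -
  have "(\<lambda>L. real (card (U \<inter> bases L))) \<in> borel_measurable X2_borel"
    unfolding borel_measurable_iff_ge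
  proof
    fix a :: real
    have "{L \<in> space X2_borel. a \<le> real (card (U \<inter> bases L))} = {L \<in> X2. nat \<lceil>a\<rceil> \<le> card (U \<inter> bases L)}"
      by (auto simp: space_X2_borel ceiling_le_iff nat_le_iff)
    then show "{L \<in> space X2_borel. a \<le> real (card (U \<inter> bases L))} \<in> sets X2_borel"
      by (simp only: many_bases_open[OF assms])
  qed
  then have "(\<lambda>L. ennreal (real (card (U \<inter> bases L)))) \<in> borel_measurable X2_borel"
    by measurable
  moreover have "bases_count U = (\<lambda>L. ennreal (real (card (U \<inter> bases L))))"
    using bases_count_bounded_set[OF assms(2)] by blast
  ultimately show ?thesis by simp
qed

lemma bases_count_UN:
  assumes "disjoint_family A"
  shows "bases_count (\<Union>i::nat. A i) L = (\<Sum>i. bases_count (A i) L)"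
proof -
  have "disjoint_family (\<lambda>i. A i \<inter> bases L)"
    using assms by (auto simp: disjoint_family_on_def)
  then show ?thesis
    unfolding bases_count_def by (subst suminf_emeasure) auto
qed

text \<open>The Borel sets for which this holds form a Dynkin system. Intersecting with a bounded set keeps the
  counts finite, so that complements correspond to differences.\<close>

lemma measurable_bases_count_Int:
  assumes U: "open U" "bounded U" and B: "B \<in> sets borel"
  shows "bases_count (B \<inter> U) \<in> borel_measurable X2_borel"
proof -
  have "Int_stable {S :: (real^2^2) set. open S}" by (auto simp: Int_stable_def)
  moreover have "{S :: (real^2^2) set. open S} \<subseteq> Pow UNIV" by simp
  moreover have "B \<in> sigma_sets UNIV {S :: (real^2^2) set. open S}"
    using B by (simp add: borel_def)
  ultimately show ?thesis
  proof (induction rule: sigma_sets_induct_disjoint)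
    case (basic A)
    then show ?case using U by (intro measurable_bases_count_open) (auto intro: bounded_Int)
  next
    case empty
    show ?case by (simp add: bases_count_def[abs_def])
  next
    case (compl A)
    obtain C where C: "\<And>L. bases_count U L \<le> ennreal (real C)"
      using bases_count_bounded_set[OF U(2)] by metis
    have "bases_count ((UNIV - A) \<inter> U) L = bases_count U L - bases_count (A \<inter> U) L" for L
    proof -
      have "bases_count (A \<inter> U) L \<le> bases_count U L"
        unfolding bases_count_def by (intro emeasure_mono) auto
      then have "bases_count (A \<inter> U) L \<noteq> \<infinity>"
        using C[of L] by (metis ennreal_less_top infinity_ennreal_def not_less order_trans top.not_eq_extremum)
      then show ?thesis
        unfolding bases_count_def by (subst emeasure_Diff[symmetric]) (auto intro!: arg_cong[where f="emeasure _"])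
    qed
    then have eq: "bases_count ((UNIV - A) \<inter> U) = (\<lambda>L. bases_count U L - bases_count (A \<inter> U) L)"
      by blast
    show ?case unfolding eq
      using measurable_bases_count_open[OF U] compl by measurable
  next
    case (union A)
    have "disjoint_family (\<lambda>i. A i \<inter> U)"
      using union(1) by (auto simp: disjoint_family_on_def)
    then have "bases_count (\<Union>i. A i \<inter> U) = (\<lambda>L. \<Sum>i. bases_count (A i \<inter> U) L)"
      by (intro ext bases_count_UN)
    moreover have "(\<Union>i. A i) \<inter> U = (\<Union>i. A i \<inter> U)" by blast
    ultimately have eq: "bases_count ((\<Union>i. A i) \<inter> U) = (\<lambda>L. \<Sum>i. bases_count (A i \<inter> U) L)"
      by (simp only:)
    show ?case unfolding eq using union(3) by measurable
  qed
qed

lemma measurable_bases_count [measurable]: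
  assumes B: "B \<in> sets borel"
  shows "bases_count B \<in> borel_measurable X2_borel"
proof -
  have "bases_count B L = (SUP n. bases_count (B \<inter> ball 0 (real n)) L)" for L
  proof -
    have "(\<Union>n. B \<inter> ball 0 (real n) \<inter> bases L) = B \<inter> bases L"
      using reals_Archimedean2 by auto
    moreover have "incseq (\<lambda>n. B \<inter> ball 0 (real n) \<inter> bases L)"
      by (auto simp: incseq_def)
    ultimately show ?thesis
      unfolding bases_count_def by (subst SUP_emeasure_incseq) auto
  qed
  then have "bases_count B = (\<lambda>L. SUP n. bases_count (B \<inter> ball 0 (real n)) L)" by blast
  moreover have "\<dots> \<in> borel_measurable X2_borel"
    by (intro borel_measurable_SUP measurable_bases_count_Int B) auto
  ultimately show ?thesis by simp
qed

text \<open>A lattice belongs to \<open>Q\<close> exactly if it has a basis in the preimage, and the number of these bases is a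
  measurable function. Hence \<open>Q\<close> is Borel although its preimage need not be open.\<close>

lemma X2_borel_if_borel_preimage:
  assumes "Q \<subseteq> X2" "{M \<in> SL2R. int_lattice M \<in> Q} \<in> sets borel"
  shows "Q \<in> sets X2_borel"
proof -
  let ?B = "{M \<in> SL2R. int_lattice M \<in> Q}"
  have "bases_count ?B L \<noteq> 0 \<longleftrightarrow> L \<in> Q" if "L \<in> X2" for L
  proof -
    have "?B \<inter> bases L = (if L \<in> Q then bases L else {})"
      by (auto simp: bases_def)
    moreover have "bases L \<noteq> {}" using that by (auto simp: X2_iff bases_def)
    ultimately show ?thesis by (auto simp: bases_count_def emeasure_count_space_eq_0)
  qed
  then have "Q = {L \<in> space X2_borel. bases_count ?B L \<noteq> 0}"
    using assms(1) by (auto simp: space_X2_borel)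
  also have "\<dots> \<in> sets X2_borel" using assms(2) by measurable
  finally show ?thesis .
qed

text \<open>Right multiplication by \<open>A\<close> is continuous on matrices, so preimages of open sets of lattices are open.\<close>

lemma measurable_lattice_act:
  assumes "A \<in> SL2R"
  shows "lattice_act A \<in> X2_borel \<rightarrow>\<^sub>M X2_borel"
proof -
  let ?G = "{U. U \<subseteq> X2 \<and> openin (top_of_set SL2R) {M \<in> SL2R. int_lattice M \<in> U}}"
  have "lattice_act A \<in> X2_borel \<rightarrow>\<^sub>M sigma X2 ?G"
  proof (rule measurable_measure_of)
    show "lattice_act A \<in> space X2_borel \<rightarrow> X2"
      using assms by (auto simp: space_X2_borel lattice_act_X2)
    fix U assume U: "U \<in> ?G"
    have cont: "continuous_on SL2R (\<lambda>M :: real^2^2. M ** A)" by (intro continuous_intros)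
    have "openin (top_of_set SL2R) (SL2R \<inter> (\<lambda>M. M ** A) -` {M \<in> SL2R. int_lattice M \<in> U})"
    proof (rule continuous_openin_preimage[OF cont])
      show "(\<lambda>M. M ** A) \<in> SL2R \<rightarrow> SL2R" using assms by (simp add: SL2R_mult)
    qed (use U in blast)
    also have "SL2R \<inter> (\<lambda>M. M ** A) -` {M \<in> SL2R. int_lattice M \<in> U} =
        {M \<in> SL2R. int_lattice M \<in> lattice_act A -` U \<inter> X2}"
      using assms by (auto simp: SL2R_mult lattice_act_int_lattice int_lattice_in_X2)
    finally show "lattice_act A -` U \<inter> space X2_borel \<in> sets X2_borel"
      unfolding space_X2_borel by (intro open_in_X2_borel) auto
  qed auto
  then show ?thesis by (simp add: X2_borel_def)
qed

locale invariant_lattice_prob =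
  fixes \<mu> :: "(real^2) set measure"
  assumes invariant: "is_invariant_prob \<mu>"
begin

sublocale prob_space \<mu>
  using invariant by (simp add: is_invariant_prob_def)

lemma sets_mu [measurable_cong]: "sets \<mu> = sets X2_borel"
  using invariant by (simp add: is_invariant_prob_def)

lemma space_mu: "space \<mu> = X2"
  using sets_eq_imp_space_eq[OF sets_mu] by (simp add: space_X2_borel)

lemma distr_lattice_act: "A \<in> SL2R \<Longrightarrow> distr \<mu> \<mu> (lattice_act A) = \<mu>"
  using invariant by (simp add: is_invariant_prob_def)

lemma measurable_lattice_act_mu: "A \<in> SL2R \<Longrightarrow> lattice_act A \<in> \<mu> \<rightarrow>\<^sub>M \<mu>"
  using measurable_lattice_act measurable_cong_sets[OF sets_mu sets_mu] by blast

text \<open>The lift of the probability from the space of lattices, a quotient of \<open>SL(2, \<real>)\<close>, to that group: each lattice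
  is replaced by the counting measure on its bases.\<close>

definition basis_measure :: "(real^2^2) measure" where
  "basis_measure = measure_of UNIV (sets borel) (\<lambda>B. \<integral>\<^sup>+L. bases_count B L \<partial>\<mu>)"

lemma sets_basis_measure [measurable_cong, simp]: "sets basis_measure = sets borel"
  unfolding basis_measure_def by (simp add: sets_measure_of_conv sets.sigma_sets_eq[of borel, simplified])

lemma space_basis_measure [simp]: "space basis_measure = UNIV"
  unfolding basis_measure_def by (simp add: space_measure_of_conv)

lemma emeasure_basis_measure:
  assumes "B \<in> sets borel"
  shows "emeasure basis_measure B = (\<integral>\<^sup>+L. bases_count B L \<partial>\<mu>)"
proof (rule emeasure_measure_of[OF basis_measure_def])
  show "positive (sets basis_measure) (\<lambda>B. \<integral>\<^sup>+L. bases_count B L \<partial>\<mu>)"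
    by (simp add: positive_def bases_count_def)
  show "countably_additive (sets basis_measure) (\<lambda>B. \<integral>\<^sup>+L. bases_count B L \<partial>\<mu>)"
  proof (rule countably_additiveI)
    fix A :: "nat \<Rightarrow> (real^2^2) set"
    assume A: "range A \<subseteq> sets basis_measure" "disjoint_family A"
    have [measurable]: "A i \<in> sets borel" for i using A(1) by auto
    show "(\<Sum>i. \<integral>\<^sup>+L. bases_count (A i) L \<partial>\<mu>) = (\<integral>\<^sup>+L. bases_count (\<Union>i. A i) L \<partial>\<mu>)"
      unfolding bases_count_UN[OF A(2)] by (rule nn_integral_suminf[symmetric]) measurable
  qed
qed (use assms in auto)

text \<open>The number of bases in a ball is bounded uniformly in the lattice.\<close>

lemma sigma_finite_basis_measure: "sigma_finite_measure basis_measure"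
proof
  have "emeasure basis_measure (ball 0 (real n)) \<noteq> \<infinity>" for n
  proof -
    obtain C where C: "\<And>L. bases_count (ball 0 (real n)) L \<le> ennreal (real C)"
      using bases_count_bounded_set[of "ball 0 (real n)"] by (metis bounded_ball)
    have "emeasure basis_measure (ball 0 (real n)) \<le> (\<integral>\<^sup>+L. ennreal (real C) \<partial>\<mu>)"
      by (subst emeasure_basis_measure, simp) (intro nn_integral_mono C)
    also have "\<dots> = ennreal (real C)" by (simp add: emeasure_space_1)
    finally show ?thesis by (auto simp: top_unique)
  qed
  moreover have "(\<Union>n. ball 0 (real n)) = (UNIV :: (real^2^2) set)"
    using reals_Archimedean2 by auto
  ultimately show "\<exists>A. countable A \<and> A \<subseteq> sets basis_measure \<and> \<Union>A = space basis_measure \<and> (\<forall>a\<in>A. emeasure basis_measure a \<noteq> \<infinity>)"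
    by (intro exI[of _ "range (\<lambda>n. ball 0 (real n))"]) auto
qed

lemma basis_measure_null: "emeasure basis_measure (- SL2R) = 0"
proof -
  have "bases_count (- SL2R) L = 0" for L
    by (auto simp: bases_count_def emeasure_count_space_eq_0 bases_def)
  then have "(\<integral>\<^sup>+L. bases_count (- SL2R) L \<partial>\<mu>) = (\<integral>\<^sup>+L. 0 \<partial>\<mu>)" by (intro nn_integral_cong)
  then show ?thesis by (subst emeasure_basis_measure) auto
qed

text \<open>Right multiplication by \<open>A\<close> maps the bases of \<open>L\<close> onto the bases of the image of \<open>L\<close>, which has the same
  distribution as \<open>L\<close>.\<close>

lemma basis_measure_invariant:
  assumes A: "A \<in> SL2R"
  shows "distr basis_measure borel (\<lambda>M. M ** A) = basis_measure"
proof (rule measure_eqI)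
  fix B assume "B \<in> sets (distr basis_measure borel (\<lambda>M. M ** A))"
  then have B [measurable]: "B \<in> sets borel" by simp
  let ?B = "(\<lambda>M. M ** A) -` B"
  have B' [measurable]: "?B \<in> sets borel"
    using measurable_sets[of "\<lambda>M :: real^2^2. M ** A" borel borel B] by simp
  have count: "bases_count ?B L = bases_count B (lattice_act A L)" if "L \<in> X2" for L
  proof -
    have im: "(\<lambda>M. M ** A) ` (?B \<inter> bases L) = B \<inter> bases (lattice_act A L)"
    proof (intro equalityI subsetI)
      fix N assume "N \<in> B \<inter> bases (lattice_act A L)"
      then have "N = (N ** adj2 A) ** A" "N ** adj2 A \<in> ?B \<inter> bases L"
        using bases_lattice_act[OF A that] A by auto
      then show "N \<in> (\<lambda>M. M ** A) ` (?B \<inter> bases L)" by blast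
    next
      fix N assume "N \<in> (\<lambda>M. M ** A) ` (?B \<inter> bases L)"
      then obtain M where M: "N = M ** A" "M ** A \<in> B" "M \<in> bases L" by blast
      have "N ** adj2 A \<in> bases L" using M(1,3) A by simp
      then show "N \<in> B \<inter> bases (lattice_act A L)"
        using M(1,2) bases_lattice_act[OF A that, of N] by blast
    qed
    have bij: "bij_betw (\<lambda>M. M ** A) (?B \<inter> bases L) (B \<inter> bases (lattice_act A L))"
      by (rule bij_betw_imageI[OF inj_mult_right[OF A] im])
    show ?thesis
      using bij_betw_same_card[OF bij] bij_betw_finite[OF bij]
      by (simp only: bases_count_def emeasure_count_space[OF subset_UNIV])
  qed
  have "emeasure (distr basis_measure borel (\<lambda>M. M ** A)) B = emeasure basis_measure ?B"
    by (subst emeasure_distr) auto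
  also have "\<dots> = (\<integral>\<^sup>+L. bases_count B (lattice_act A L) \<partial>\<mu>)"
    by (subst emeasure_basis_measure) (auto intro!: nn_integral_cong simp: count space_mu)
  also have "\<dots> = (\<integral>\<^sup>+L. bases_count B L \<partial>distr \<mu> \<mu> (lattice_act A))"
    using measurable_lattice_act_mu[OF A] by (subst nn_integral_distr) auto
  also have "\<dots> = emeasure basis_measure B"
    by (simp add: distr_lattice_act[OF A] emeasure_basis_measure)
  finally show "emeasure (distr basis_measure borel (\<lambda>M. M ** A)) B = emeasure basis_measure B" .
qed simp

end

section \<open>Haar measure in coordinates\<close>

text \<open>The entries other than the one at position \<open>(2, 1)\<close>, which the determinant then fixes, are coordinates on the
  part of \<open>SL(2, \<real>)\<close> where \<open>q \<noteq> 0\<close>, whose complement is a null set. In them Haar measure has the density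
  \<open>1 / \<bar>q\<bar>\<close>.\<close>

definition chart :: "real \<times> real \<times> real \<Rightarrow> real^2^2" where
  "chart = (\<lambda>(q, s, p). mat2 p q ((p * s - 1) / q) s)"

definition haar :: "(real^2^2 \<Rightarrow> ennreal) \<Rightarrow> ennreal" where
  "haar f = (\<integral>\<^sup>+z. f (chart z) * ennreal (1 / \<bar>fst z\<bar>) \<partial>(lborel \<Otimes>\<^sub>M (lborel \<Otimes>\<^sub>M lborel)))"

lemma measurable_chart [measurable]: "chart \<in> borel \<Otimes>\<^sub>M (borel \<Otimes>\<^sub>M borel) \<rightarrow>\<^sub>M borel"
  unfolding chart_def by measurable

lemma chart_SL2R: "fst z \<noteq> 0 \<Longrightarrow> chart z \<in> SL2R"
  by (auto simp: SL2R_det chart_def case_prod_beta)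

lemma sigma_finite_chart_space:
  "sigma_finite_measure (lborel \<Otimes>\<^sub>M lborel :: (real \<times> real) measure)"
  "sigma_finite_measure (lborel \<Otimes>\<^sub>M (lborel \<Otimes>\<^sub>M lborel) :: (real \<times> real \<times> real) measure)"
  by (intro sigma_finite_pair_measure lborel.sigma_finite_measure_axioms)+

lemma haar_iterated:
  assumes [measurable]: "f \<in> borel_measurable borel"
  shows "haar f = (\<integral>\<^sup>+q. \<integral>\<^sup>+s. \<integral>\<^sup>+p. f (mat2 p q ((p * s - 1) / q) s) * ennreal (1 / \<bar>q\<bar>)
           \<partial>lborel \<partial>lborel \<partial>lborel)"
proof -
  have "haar f = (\<integral>\<^sup>+q. \<integral>\<^sup>+y. f (chart (q, y)) * ennreal (1 / \<bar>q\<bar>) \<partial>(lborel \<Otimes>\<^sub>M lborel) \<partial>lborel)"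
    unfolding haar_def by (subst sigma_finite_measure.nn_integral_fst[OF sigma_finite_chart_space(1), symmetric]) auto
  also have "\<dots> = (\<integral>\<^sup>+q. \<integral>\<^sup>+s. \<integral>\<^sup>+p. f (chart (q, s, p)) * ennreal (1 / \<bar>q\<bar>) \<partial>lborel \<partial>lborel \<partial>lborel)"
    by (intro nn_integral_cong, subst lborel.nn_integral_fst[symmetric]) auto
  finally show ?thesis by (simp add: chart_def)
qed

lemma swap_inner:
  fixes f :: "real \<Rightarrow> real \<Rightarrow> ennreal"
  assumes [measurable]: "case_prod f \<in> borel_measurable (borel \<Otimes>\<^sub>M borel)"
  shows "(\<integral>\<^sup>+x. \<integral>\<^sup>+y. f x y \<partial>lborel \<partial>lborel) = (\<integral>\<^sup>+y. \<integral>\<^sup>+x. f x y \<partial>lborel \<partial>lborel)"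
  by (intro lborel_pair.Fubini'[symmetric]) measurable

definition haar_left_inv :: "real^2^2 \<Rightarrow> bool" where
  "haar_left_inv A \<longleftrightarrow> (\<forall>f\<in>borel_measurable borel. haar (\<lambda>M. f (A ** M)) = haar f)"

lemma haar_left_inv_mult:
  assumes "haar_left_inv A" "haar_left_inv B"
  shows "haar_left_inv (A ** B)"
  unfolding haar_left_inv_def
proof
  fix f :: "real^2^2 \<Rightarrow> ennreal" assume f [measurable]: "f \<in> borel_measurable borel"
  have "haar (\<lambda>M. f (A ** B ** M)) = haar (\<lambda>M. (\<lambda>N. f (A ** N)) (B ** M))"
    by (simp add: matrix_mul_assoc)
  also have "\<dots> = haar (\<lambda>N. f (A ** N))"
    using assms(2) unfolding haar_left_inv_def by (rule bspec) measurable
  also have "\<dots> = haar f"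
    using assms(1) f unfolding haar_left_inv_def by blast
  finally show "haar (\<lambda>M. f (A ** B ** M)) = haar f" .
qed

text \<open>Such a shear translates the coordinate \<open>s\<close> by \<open>t q\<close> and fixes \<open>p\<close> and \<open>q\<close>.\<close>

lemma haar_left_inv_lower: "haar_left_inv (mat2 1 0 t 1)"
  unfolding haar_left_inv_def
proof
  fix f :: "real^2^2 \<Rightarrow> ennreal" assume [measurable]: "f \<in> borel_measurable borel"
  let ?g = "\<lambda>q s p. f (mat2 p q ((p * s - 1) / q) s) * ennreal (1 / \<bar>q\<bar>)"
  have inner: "(\<integral>\<^sup>+s. \<integral>\<^sup>+p. f (mat2 1 0 t 1 ** mat2 p q ((p * s - 1) / q) s) * ennreal (1 / \<bar>q\<bar>) \<partial>lborel \<partial>lborel)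
      = (\<integral>\<^sup>+s. \<integral>\<^sup>+p. ?g q s p \<partial>lborel \<partial>lborel)" (is "?L = ?R") if "q \<noteq> 0" for q
  proof -
    have "?L = (\<integral>\<^sup>+p. \<integral>\<^sup>+s. f (mat2 1 0 t 1 ** mat2 p q ((p * s - 1) / q) s) * ennreal (1 / \<bar>q\<bar>) \<partial>lborel \<partial>lborel)"
      by (rule swap_inner) measurable
    also have "\<dots> = (\<integral>\<^sup>+p. \<integral>\<^sup>+s. ?g q (t * q + 1 * s) p \<partial>lborel \<partial>lborel)"
      using that by (intro nn_integral_cong) (simp add: mat2_mult field_simps)
    also have "\<dots> = (\<integral>\<^sup>+p. \<integral>\<^sup>+s. ?g q s p \<partial>lborel \<partial>lborel)"
    proof (rule nn_integral_cong)
      fix p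
      show "(\<integral>\<^sup>+s. ?g q (t * q + 1 * s) p \<partial>lborel) = (\<integral>\<^sup>+s. ?g q s p \<partial>lborel)"
        using nn_integral_real_affine[of "\<lambda>s. ?g q s p" 1 "t * q"] by simp
    qed
    also have "\<dots> = ?R"
      by (rule swap_inner) measurable
    finally show ?thesis .
  qed
  show "haar (\<lambda>M. f (mat2 1 0 t 1 ** M)) = haar f"
    by (subst (1 2) haar_iterated; (measurable)?)
       (intro nn_integral_cong_AE, use AE_lborel_singleton[of "0::real"] in eventually_elim, simp add: inner)
qed

text \<open>Multiplication by the quarter turn gives a matrix with first row \<open>(- r, - s)\<close>, whose coordinates involve
  \<open>r\<close> instead of \<open>p\<close>. For a fixed second column \<open>(q, s)\<close> the entries \<open>p\<close> and \<open>r\<close> depend on each other affinely,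
  and the factor \<open>\<bar>q / s\<bar>\<close> of this substitution turns the density \<open>1 / \<bar>q\<bar>\<close> into \<open>1 / \<bar>s\<bar>\<close>.\<close>

lemma haar_left_inv_J: "haar_left_inv (mat2 0 (-1) 1 0)"
  unfolding haar_left_inv_def
proof
  fix f :: "real^2^2 \<Rightarrow> ennreal" assume [measurable]: "f \<in> borel_measurable borel"
  let ?g = "\<lambda>q s p. f (mat2 p q ((p * s - 1) / q) s) * ennreal (1 / \<bar>q\<bar>)"
  let ?J = "mat2 0 (-1) 1 0"
  \<comment> \<open>For fixed second column, exchange the coordinate \<open>p\<close> for the other entry of the first column.\<close>
  have inner: "(\<integral>\<^sup>+p. f (?J ** mat2 p q ((p * s - 1) / q) s) * ennreal (1 / \<bar>q\<bar>) \<partial>lborel)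
      = (\<integral>\<^sup>+p. ?g (- s) q p \<partial>lborel)" (is "?L = ?R") if "q \<noteq> 0" "s \<noteq> 0" for q s
  proof -
    have "?L = \<bar>- q / s\<bar> * (\<integral>\<^sup>+p. f (?J ** mat2 (1/s + (- q / s) * p) q (((1/s + (- q / s) * p) * s - 1) / q) s) * ennreal (1 / \<bar>q\<bar>) \<partial>lborel)"
      using that by (subst nn_integral_real_affine[where t="1/s" and c="- q / s"]) auto
    also have "\<dots> = (\<integral>\<^sup>+p. \<bar>- q / s\<bar> * (f (?J ** mat2 (1/s + (- q / s) * p) q (((1/s + (- q / s) * p) * s - 1) / q) s) * ennreal (1 / \<bar>q\<bar>)) \<partial>lborel)"
      by (subst nn_integral_cmult) auto
    also have "\<dots> = ?R"
    proof (intro nn_integral_cong)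
      fix p :: real
      have a: "?J ** mat2 (1/s + (- q / s) * p) q (((1/s + (- q / s) * p) * s - 1) / q) s =
          mat2 p (-s) ((p * q - 1) / (- s)) q"
        using that by (simp add: mat2_mult matrix_2_eq_iff field_simps)
      have b: "ennreal \<bar>- q / s\<bar> * ennreal (1 / \<bar>q\<bar>) = ennreal (1 / \<bar>- s\<bar>)"
        using that by (subst ennreal_mult[symmetric]) (auto simp: abs_mult)
      show "\<bar>- q / s\<bar> * (f (?J ** mat2 (1/s + (- q / s) * p) q (((1/s + (- q / s) * p) * s - 1) / q) s) * ennreal (1 / \<bar>q\<bar>)) = ?g (- s) q p"
        unfolding a b[symmetric] by (simp add: mult_ac)
    qed
    finally show ?thesis .
  qed
  have "haar (\<lambda>M. f (?J ** M)) = (\<integral>\<^sup>+q. \<integral>\<^sup>+s. \<integral>\<^sup>+p. ?g (- s) q p \<partial>lborel \<partial>lborel \<partial>lborel)"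
    by (subst haar_iterated; (measurable)?)
       (intro nn_integral_cong_AE, use AE_lborel_singleton[of "0::real"] in eventually_elim,
        intro nn_integral_cong_AE, use AE_lborel_singleton[of "0::real"] in eventually_elim,
        simp add: inner)
  also have "\<dots> = (\<integral>\<^sup>+s. \<integral>\<^sup>+q. \<integral>\<^sup>+p. ?g (- s) q p \<partial>lborel \<partial>lborel \<partial>lborel)"
    by (rule swap_inner) measurable
  also have "\<dots> = (\<integral>\<^sup>+s. \<integral>\<^sup>+q. \<integral>\<^sup>+p. ?g s q p \<partial>lborel \<partial>lborel \<partial>lborel)"
    by (subst (2) nn_integral_real_affine[where t=0 and c="-1"]) auto
  also have "\<dots> = haar f"
    by (subst haar_iterated) auto
  finally show "haar (\<lambda>M. f (?J ** M)) = haar f" .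
qed

text \<open>Lower shears and the quarter turn generate \<open>SL(2, \<real>)\<close>: conjugating with the quarter turn gives the upper
  shears, and a matrix whose entry at \<open>(2, 1)\<close> is not zero is an upper, a lower and an upper shear multiplied.\<close>

lemma haar_left_inv_SL2R:
  assumes "A \<in> SL2R"
  shows "haar_left_inv A"
proof -
  let ?J = "mat2 0 (-1) 1 0" and ?L = "\<lambda>t. mat2 1 0 t 1"
  have U: "haar_left_inv (mat2 1 t 0 1)" for t
  proof -
    have "mat2 1 t 0 1 = ?J ** ?L (-t) ** (?J ** (?J ** ?J))"
      by (simp add: mat2_mult)
    then show ?thesis
      by (simp only:) (intro haar_left_inv_mult haar_left_inv_J haar_left_inv_lower)
  qed
  have *: "haar_left_inv A" if "A \<in> SL2R" "A$2$1 \<noteq> 0" for A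
  proof -
    obtain p q r s where A: "A = mat2 p q r s" by (metis mat2_eta)
    have "r \<noteq> 0" "p * s - q * r = 1" using that by (auto simp: A SL2R_det)
    then have "mat2 p q r s = mat2 1 ((p-1)/r) 0 1 ** ?L r ** mat2 1 ((s-1)/r) 0 1"
      by (simp add: mat2_mult matrix_2_eq_iff field_simps)
    then show ?thesis
      unfolding A by (simp only:) (intro haar_left_inv_mult U haar_left_inv_lower)
  qed
  show ?thesis
  proof (cases "A$2$1 = 0")
    case True
    then have "A$2$2 \<noteq> 0" using assms by (auto simp: SL2R_det)
    then have "haar_left_inv (A ** ?L 1)"
      using True assms by (intro * SL2R_mult) (auto simp: mult_nth_2 SL2R_det)
    then have "haar_left_inv (A ** ?L 1 ** ?L (-1))"
      by (rule haar_left_inv_mult[OF _ haar_left_inv_lower])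
    moreover have "?L 1 ** ?L (-1) = mat 1"
      by (simp add: mat2_mult matrix_2_eq_iff mat_def)
    ultimately show ?thesis
      by (metis matrix_mul_assoc matrix_mul_rid)
  qed (use * assms in auto)
qed

lemma haar_left_mult:
  assumes "A \<in> SL2R" "f \<in> borel_measurable borel"
  shows "haar (\<lambda>M. f (A ** M)) = haar f"
  using haar_left_inv_SL2R[OF assms(1)] assms(2) unfolding haar_left_inv_def by blast

text \<open>On \<open>SL(2, \<real>)\<close> the adjugate is the inverse; in coordinates it exchanges \<open>p\<close> with \<open>s\<close> and negates \<open>q\<close>.\<close>

lemma haar_adj2:
  assumes [measurable]: "f \<in> borel_measurable borel"
  shows "haar (\<lambda>M. f (adj2 M)) = haar f"
proof -
  let ?g = "\<lambda>q s p. f (mat2 p q ((p * s - 1) / q) s) * ennreal (1 / \<bar>q\<bar>)"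
  have "haar (\<lambda>M. f (adj2 M)) = (\<integral>\<^sup>+q. \<integral>\<^sup>+s. \<integral>\<^sup>+p. ?g (- q) p s \<partial>lborel \<partial>lborel \<partial>lborel)"
    by (subst haar_iterated; (measurable)?) (simp add: adj2_def mult.commute)
  also have "\<dots> = (\<integral>\<^sup>+q. \<integral>\<^sup>+s. \<integral>\<^sup>+p. ?g q p s \<partial>lborel \<partial>lborel \<partial>lborel)"
    by (subst (2) nn_integral_real_affine[where t=0 and c="-1"]) auto
  also have "\<dots> = (\<integral>\<^sup>+q. \<integral>\<^sup>+p. \<integral>\<^sup>+s. ?g q p s \<partial>lborel \<partial>lborel \<partial>lborel)"
    by (intro nn_integral_cong swap_inner) measurable
  also have "\<dots> = haar f"
    by (subst haar_iterated) auto
  finally show ?thesis .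
qed

text \<open>Uniqueness of Haar measure by Fubini: the double integral of \<open>f M * g (M Y\<^sup>-\<^sup>1)\<close>, with \<open>M\<close> distributed by \<open>N\<close>
  and \<open>Y\<close> by Haar measure, is evaluated in both orders. Integrating over \<open>Y\<close> first, inversion and left
  translation give the left-hand side; substituting \<open>M Y\<close> for \<open>M\<close> first, which does not change \<open>N\<close>, gives the
  right-hand side.\<close>

lemma haar_unique:
  assumes "sigma_finite_measure N" and sets [measurable_cong]: "sets N = sets borel"
    and null: "N (- SL2R) = 0"
    and inv: "\<And>A. A \<in> SL2R \<Longrightarrow> distr N borel (\<lambda>M. M ** A) = N"
    and [measurable]: "f \<in> borel_measurable borel" "g \<in> borel_measurable borel"
  shows "(\<integral>\<^sup>+M. f M \<partial>N) * haar g = (\<integral>\<^sup>+M. g M \<partial>N) * haar f"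
proof -
  interpret sigma_finite_measure N by fact
  interpret P: pair_sigma_finite N "lborel \<Otimes>\<^sub>M (lborel \<Otimes>\<^sub>M lborel) :: (real \<times> real \<times> real) measure"
    by (intro pair_sigma_finite.intro sigma_finite_measure_axioms sigma_finite_chart_space)
  have AE: "AE M in N. M \<in> SL2R"
    using null sets by (intro AE_I[of _ _ "- SL2R"]) auto
  have AE2: "AE z in lborel \<Otimes>\<^sub>M (lborel \<Otimes>\<^sub>M lborel). chart z \<in> SL2R"
  proof (rule pair_sigma_finite.AE_pair_measure[OF pair_sigma_finite.intro[OF lborel.sigma_finite_measure_axioms sigma_finite_chart_space(1)]])
    show "AE q in lborel. AE y in lborel \<Otimes>\<^sub>M lborel. chart (q, y) \<in> SL2R"
      using AE_lborel_singleton[of "0::real"] by eventually_elim (simp add: chart_SL2R)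
  qed measurable
  have cong: "(\<integral>\<^sup>+M. h M \<partial>N) = (\<integral>\<^sup>+M. h (M ** A) \<partial>N)"
    if [measurable]: "h \<in> borel_measurable borel" and "A \<in> SL2R" for h A
    by (subst inv[OF that(2), symmetric]) (simp add: nn_integral_distr)
  have "(\<integral>\<^sup>+M. f M \<partial>N) * haar g = (\<integral>\<^sup>+M. f M * haar g \<partial>N)"
    by (subst nn_integral_multc) auto
  also have "\<dots> = (\<integral>\<^sup>+M. f M * haar (\<lambda>Y. g (M ** adj2 Y)) \<partial>N)"
  proof (rule nn_integral_cong_AE, use AE in eventually_elim)
    case (elim M)
    have "haar (\<lambda>Y. g (M ** adj2 Y)) = haar (\<lambda>Y. g (M ** Y))"
      by (rule haar_adj2[where f="\<lambda>Y. g (M ** Y)"]) measurable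
    also have "\<dots> = haar g" by (rule haar_left_mult[OF elim]) measurable
    finally show ?case by simp
  qed
  also have "\<dots> = (\<integral>\<^sup>+M. \<integral>\<^sup>+z. f M * (g (M ** adj2 (chart z)) * ennreal (1 / \<bar>fst z\<bar>)) \<partial>(lborel \<Otimes>\<^sub>M (lborel \<Otimes>\<^sub>M lborel)) \<partial>N)"
    unfolding haar_def by (intro nn_integral_cong) (subst nn_integral_cmult, auto)
  also have "\<dots> = (\<integral>\<^sup>+z. \<integral>\<^sup>+M. f M * (g (M ** adj2 (chart z)) * ennreal (1 / \<bar>fst z\<bar>)) \<partial>N \<partial>(lborel \<Otimes>\<^sub>M (lborel \<Otimes>\<^sub>M lborel)))"
    by (rule P.Fubini'[symmetric]) measurable
  also have "\<dots> = (\<integral>\<^sup>+z. \<integral>\<^sup>+M. f (M ** chart z) * (g M * ennreal (1 / \<bar>fst z\<bar>)) \<partial>N \<partial>(lborel \<Otimes>\<^sub>M (lborel \<Otimes>\<^sub>M lborel)))"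
  proof (rule nn_integral_cong_AE, use AE2 in eventually_elim)
    case (elim z)
    show ?case
      by (subst cong[OF _ elim]) (use elim in \<open>auto simp: mult_adj2_cancel\<close>)
  qed
  also have "\<dots> = (\<integral>\<^sup>+M. \<integral>\<^sup>+z. f (M ** chart z) * (g M * ennreal (1 / \<bar>fst z\<bar>)) \<partial>(lborel \<Otimes>\<^sub>M (lborel \<Otimes>\<^sub>M lborel)) \<partial>N)"
    by (rule P.Fubini') measurable
  also have "\<dots> = (\<integral>\<^sup>+M. \<integral>\<^sup>+z. g M * (f (M ** chart z) * ennreal (1 / \<bar>fst z\<bar>)) \<partial>(lborel \<Otimes>\<^sub>M (lborel \<Otimes>\<^sub>M lborel)) \<partial>N)"
    by (simp add: mult_ac)
  also have "\<dots> = (\<integral>\<^sup>+M. g M * haar (\<lambda>Y. f (M ** Y)) \<partial>N)"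
    unfolding haar_def by (intro nn_integral_cong) (subst nn_integral_cmult, auto)
  also have "\<dots> = (\<integral>\<^sup>+M. g M * haar f \<partial>N)"
    by (rule nn_integral_cong_AE, use AE in eventually_elim) (simp add: haar_left_mult)
  also have "\<dots> = (\<integral>\<^sup>+M. g M \<partial>N) * haar f"
    by (subst nn_integral_multc) auto
  finally show ?thesis .
qed

section \<open>The elementary integrals\<close>

text \<open>The value \<open>0\<close> at \<open>0\<close> is also the limit there. This makes the density below continuous at the
  transition points, in particular at \<open>R = 1\<close>.\<close>

definition xlog :: "real \<Rightarrow> real" where
  "xlog x = - x * ln \<bar>x\<bar>"

lemma xlog_simps [simp]: "xlog 0 = 0" "xlog 1 = 0" "xlog (- x) = - xlog x"
  by (simp_all add: xlog_def)

lemma has_derivative_xlog: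
  assumes "x > 0"
  shows "(xlog has_real_derivative (- ln x - 1)) (at x)"
proof -
  have "((\<lambda>x. - x * ln x) has_real_derivative (- ln x - 1)) (at x)"
    using assms by (auto intro!: derivative_eq_intros)
  then show ?thesis
    by (rule has_field_derivative_transform_within_open[where S="{0<..}"])
       (use assms in \<open>auto simp: xlog_def\<close>)
qed

lemma isCont_xlog: "isCont xlog x"
proof (cases "x = 0")
  case True
  have "(xlog \<longlongrightarrow> 0) (at_right 0)" "(xlog \<longlongrightarrow> 0) (at_left 0)"
    unfolding xlog_def[abs_def] by real_asymp+
  then show ?thesis
    using True by (simp add: isCont_def filterlim_split_at)
next
  case False
  have "isCont (\<lambda>x. - x * ln \<bar>x\<bar>) x"
    using False by (intro continuous_intros) auto
  then show ?thesis by (simp add: xlog_def[abs_def])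
qed

lemma continuous_on_xlog [continuous_intros]:
  assumes "continuous_on S f"
  shows "continuous_on S (\<lambda>x. xlog (f x))"
proof -
  have "continuous_on UNIV xlog"
    using isCont_xlog by (simp add: continuous_at_imp_continuous_on)
  then show ?thesis using assms by (rule continuous_on_compose2) auto
qed

text \<open>This will be the density, up to the factor \<open>6 / pi\<^sup>2\<close>, of the width \<open>t = a + b\<close> of the canonical basis.\<close>

definition width_density :: "real \<Rightarrow> real" where
  "width_density t = (if t \<le> 1 then 0 else 2 * xlog (1 - 1/t) + xlog (2/t - 1))"

lemma continuous_on_width_density: "continuous_on S width_density"
proof -
  have "width_density = (\<lambda>t. 2 * xlog (1 - 1 / max 1 t) + xlog (2 / max 1 t - 1))"
    by (rule ext) (auto simp: width_density_def max_def)
  moreover have "continuous_on S (\<lambda>t. 2 * xlog (1 - 1 / max 1 t) + xlog (2 / max 1 t - 1))"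
    by (intro continuous_intros) auto
  ultimately show ?thesis by (simp only:)
qed

lemma measurable_width_density [measurable]: "width_density \<in> borel_measurable borel"
  by (rule borel_measurable_continuous_onI[OF continuous_on_width_density])

lemma inner_log_integral:
  fixes a m :: real
  assumes "a < m" "m \<le> 1"
  shows "(\<integral>\<^sup>+b. ennreal (1 / (b - a)) * indicator {m<..1} b \<partial>lborel) = ennreal (ln (1 - a) - ln (m - a))"
proof -
  have "(\<integral>\<^sup>+b. ennreal (1 / (b - a)) * indicator {m<..1} b \<partial>lborel) =
        (\<integral>\<^sup>+b. ennreal (1 / (b - a)) * indicator {m..1} b \<partial>lborel)"
    by (rule nn_integral_cong_AE, use AE_lborel_singleton[of m] in eventually_elim)
       (auto simp: indicator_def)
  also have "\<dots> = ennreal (ln (1 - a) - ln (m - a))"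
    by (rule nn_integral_FTC_Icc[where F="\<lambda>b. ln (b - a)"])
       (use assms in \<open>auto intro!: derivative_eq_intros simp: field_simps\<close>)
  finally show ?thesis .
qed

text \<open>The maximum changes at \<open>a = 1 - \<tau>\<close>. This point lies inside the interval only if \<open>\<tau> > 1 / 2\<close>, but both cases
  lead to the same expression in \<open>\<tau>\<close>.\<close>

lemma outer_log_integral:
  fixes \<tau> :: real
  assumes "0 < \<tau>" "\<tau> < 1"
  shows "((\<lambda>a. ln (1 - a) - ln (max \<tau> (1 - a) - a)) has_integral
           (xlog (1 - \<tau>) + xlog (2 * \<tau> - 1) / 2)) {0..\<tau>}"
proof -
  let ?g = "\<lambda>a. ln (1 - a) - ln (max \<tau> (1 - a) - a)"
  have low: "(?g has_integral (xlog (1 - c) - xlog (1 - 2 * c) / 2)) {0..c}"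
    if "0 \<le> c" "c \<le> 1/2" "c \<le> 1 - \<tau>" for c
  proof -
    let ?G = "\<lambda>a. xlog (1 - a) - xlog (1 - 2 * a) / 2"
    have "(?g has_integral (?G c - ?G 0)) {0..c}"
    proof (rule fundamental_theorem_of_calculus_interior)
      show "continuous_on {0..c} ?G" by (intro continuous_intros) auto
      fix a assume a: "a \<in> {0<..<c}"
      have "((\<lambda>a. xlog (1 - a)) has_real_derivative (- ln (1 - a) - 1) * (- 1)) (at a)"
        using that a by (intro DERIV_chain2[OF has_derivative_xlog]) (auto intro!: derivative_eq_intros)
      moreover have "((\<lambda>a. xlog (1 - 2 * a)) has_real_derivative (- ln (1 - 2 * a) - 1) * (- 2)) (at a)"
        using that a by (intro DERIV_chain2[OF has_derivative_xlog]) (auto intro!: derivative_eq_intros)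
      ultimately have "(?G has_real_derivative
          ((- ln (1 - a) - 1) * (- 1) - (- ln (1 - 2 * a) - 1) * (- 2) / 2)) (at a)"
        by (intro DERIV_diff DERIV_cdivide)
      moreover have "(- ln (1 - a) - 1) * (- 1) - (- ln (1 - 2 * a) - 1) * (- 2) / 2 = ?g a"
        using that a by (auto simp: max_def field_simps)
      ultimately show "(?G has_vector_derivative ?g a) (at a)"
        unfolding has_real_derivative_iff_has_vector_derivative by metis
    qed fact
    then show ?thesis by simp
  qed
  show ?thesis
  proof (cases "\<tau> \<le> 1/2")
    case True
    have "xlog (2 * \<tau> - 1) = - xlog (1 - 2 * \<tau>)"
      using xlog_simps(3)[of "1 - 2 * \<tau>"] by simp
    then show ?thesis using low[of \<tau>] True assms by simp
  next
    case False
    let ?G = "\<lambda>a. xlog (1 - a) - xlog (\<tau> - a)"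
    have "(?g has_integral (?G \<tau> - ?G (1 - \<tau>))) {1 - \<tau>..\<tau>}"
    proof (rule fundamental_theorem_of_calculus_interior)
      show "continuous_on {1 - \<tau>..\<tau>} ?G" by (intro continuous_intros)
      fix a assume a: "a \<in> {1 - \<tau><..<\<tau>}"
      have "((\<lambda>a. xlog (1 - a)) has_real_derivative (- ln (1 - a) - 1) * (- 1)) (at a)"
        using assms a by (intro DERIV_chain2[OF has_derivative_xlog]) (auto intro!: derivative_eq_intros)
      moreover have "((\<lambda>a. xlog (\<tau> - a)) has_real_derivative (- ln (\<tau> - a) - 1) * (- 1)) (at a)"
        using assms a by (intro DERIV_chain2[OF has_derivative_xlog]) (auto intro!: derivative_eq_intros)
      ultimately have "(?G has_real_derivative
          ((- ln (1 - a) - 1) * (- 1) - (- ln (\<tau> - a) - 1) * (- 1))) (at a)"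
        by (intro DERIV_diff)
      moreover have "(- ln (1 - a) - 1) * (- 1) - (- ln (\<tau> - a) - 1) * (- 1) = ?g a"
        using a by (auto simp: max_def)
      ultimately show "(?G has_vector_derivative ?g a) (at a)"
        unfolding has_real_derivative_iff_has_vector_derivative by metis
    qed (use False in simp)
    then have "(?g has_integral (xlog (1 - \<tau>) - (xlog \<tau> - xlog (2 * \<tau> - 1)))) {1 - \<tau>..\<tau>}"
      by simp
    moreover have "(?g has_integral (xlog \<tau> - xlog (2 * \<tau> - 1) / 2)) {0..1 - \<tau>}"
      using low[of "1 - \<tau>"] False assms by simp
    ultimately have "(?g has_integral (xlog \<tau> - xlog (2 * \<tau> - 1) / 2) +
        (xlog (1 - \<tau>) - (xlog \<tau> - xlog (2 * \<tau> - 1)))) {0..\<tau>}"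
      using False assms by (intro has_integral_combine[where c="1 - \<tau>"]) auto
    then show ?thesis by (simp add: algebra_simps)
  qed
qed

text \<open>By symmetry in \<open>\<alpha>\<close> and \<open>\<beta>\<close> this is one half of the density of the width at \<open>t = 1 / \<tau>\<close>.\<close>

lemma half_width_density_integral:
  fixes \<tau> :: real
  assumes "0 < \<tau>" "\<tau> < 1"
  shows "(\<integral>\<^sup>+a. (\<integral>\<^sup>+b. ennreal (1 / (b - a)) * indicator {max \<tau> (1 - a)<..1} b \<partial>lborel) *
            indicator {0<..<\<tau>} a \<partial>lborel)
     = ennreal (xlog (1 - \<tau>) + xlog (2 * \<tau> - 1) / 2)"
proof -
  have "(\<integral>\<^sup>+a. (\<integral>\<^sup>+b. ennreal (1 / (b - a)) * indicator {max \<tau> (1 - a)<..1} b \<partial>lborel) *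
            indicator {0<..<\<tau>} a \<partial>lborel) =
     (\<integral>\<^sup>+a. ennreal (ln (1 - a) - ln (max \<tau> (1 - a) - a)) * indicator {0<..<\<tau>} a \<partial>lborel)"
  proof (rule nn_integral_cong)
    fix a
    show "(\<integral>\<^sup>+b. ennreal (1 / (b - a)) * indicator {max \<tau> (1 - a)<..1} b \<partial>lborel) * indicator {0<..<\<tau>} a =
       ennreal (ln (1 - a) - ln (max \<tau> (1 - a) - a)) * indicator {0<..<\<tau>} a"
      using assms inner_log_integral[of a "max \<tau> (1 - a)"]
      by (cases "a \<in> {0<..<\<tau>}") (simp_all add: less_max_iff_disj)
  qed
  also have "\<dots> = ennreal (xlog (1 - \<tau>) + xlog (2 * \<tau> - 1) / 2)"
  proof (rule nn_integral_has_integral_lebesgue')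
    show "((\<lambda>a. ln (1 - a) - ln (max \<tau> (1 - a) - a)) has_integral
           (xlog (1 - \<tau>) + xlog (2 * \<tau> - 1) / 2)) {0<..<\<tau>}"
      using outer_log_integral[OF assms] by (simp add: has_integral_Icc_iff_Ioo)
    fix a assume "a \<in> {0<..<\<tau>}"
    then show "0 \<le> ln (1 - a) - ln (max \<tau> (1 - a) - a)"
      using assms by (auto simp: max_def)
  qed
  finally show ?thesis .
qed

lemma half_width_density_nonneg:
  fixes \<tau> :: real
  assumes "0 < \<tau>" "\<tau> < 1"
  shows "0 \<le> xlog (1 - \<tau>) + xlog (2 * \<tau> - 1) / 2"
proof -
  have "((\<lambda>a. ln (1 - a) - ln (max \<tau> (1 - a) - a)) has_integral
           (xlog (1 - \<tau>) + xlog (2 * \<tau> - 1) / 2)) {0<..<\<tau>}"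
    using outer_log_integral[OF assms] by (simp add: has_integral_Icc_iff_Ioo)
  then show ?thesis
    by (rule has_integral_nonneg) (use assms in \<open>auto simp: max_def\<close>)
qed

lemma width_density_nonneg: "0 \<le> width_density t"
  using half_width_density_nonneg[of "1 / t"] by (auto simp: width_density_def)

text \<open>Expanding the logarithm and integrating term by term gives the series of inverse squares.\<close>

lemma basel_integral:
  "(\<integral>\<^sup>+b. ennreal (- ln (1 - b) / b) * indicator {0<..<1} b \<partial>lborel) = ennreal (pi\<^sup>2 / 6)"
proof -
  have series: "ennreal (- ln (1 - b) / b) = (\<Sum>n. ennreal (b ^ n / real (n + 1)))"
    if "b \<in> {0<..<1}" for b :: real
  proof -
    have "(\<lambda>n. - ((- (- b)) ^ n) / of_nat n) sums ln (1 + (- b))"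
      by (rule ln_series') (use that in auto)
    then have "(\<lambda>n. b ^ n / real n) sums (- ln (1 - b))"
      by (simp add: sums_minus[of "\<lambda>n. - (b ^ n / real n)", simplified])
    then have "(\<lambda>n. b ^ (Suc n) / real (Suc n)) sums (- ln (1 - b))"
      by (subst sums_Suc_iff) simp
    then have "(\<lambda>n. b ^ (Suc n) / real (Suc n) / b) sums (- ln (1 - b) / b)"
      by (rule sums_divide)
    then have "(\<lambda>n. b ^ n / real (n + 1)) sums (- ln (1 - b) / b)"
      using that by simp
    then show ?thesis
      using that by (intro suminf_ennreal_eq[symmetric]) auto
  qed
  have monomial: "(\<integral>\<^sup>+b. ennreal (b ^ n / real (n + 1)) * indicator {0<..<1} b \<partial>lborel) =
      ennreal (1 / (real n + 1)\<^sup>2)" for n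
  proof -
    have "(\<integral>\<^sup>+b. ennreal (b ^ n / real (n + 1)) * indicator {0<..<1} b \<partial>lborel) =
      (\<integral>\<^sup>+b. ennreal (b ^ n / real (n + 1)) * indicator {0..1} b \<partial>lborel)"
      by (rule nn_integral_cong_AE,
        use AE_lborel_singleton[of "1::real"] AE_lborel_singleton[of "0::real"] in eventually_elim)
       (auto simp: indicator_def)
    also have "\<dots> = ennreal (1 ^ (n + 1) / (real n + 1)\<^sup>2 - 0 ^ (n + 1) / (real n + 1)\<^sup>2)"
    proof (rule nn_integral_FTC_Icc[where F="\<lambda>b. b ^ (n + 1) / (real n + 1)\<^sup>2"])
      fix b :: real
      have "((\<lambda>b. b ^ (n + 1) / (real n + 1)\<^sup>2) has_real_derivative real (n + 1) * b ^ n / (real n + 1)\<^sup>2) (at b)"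
        by (rule DERIV_cdivide) (use DERIV_pow[of "n + 1" b] in simp)
      moreover have "real (n + 1) * b ^ n / (real n + 1)\<^sup>2 = b ^ n / real (n + 1)"
        by (simp add: power2_eq_square add.commute)
      ultimately show "((\<lambda>b. b ^ (n + 1) / (real n + 1)\<^sup>2) has_real_derivative b ^ n / real (n + 1)) (at b)"
        by simp
    qed auto
    finally show ?thesis by simp
  qed
  have "(\<integral>\<^sup>+b. ennreal (- ln (1 - b) / b) * indicator {0<..<1} b \<partial>lborel) =
      (\<integral>\<^sup>+b. (\<Sum>n. ennreal (b ^ n / real (n + 1)) * indicator {0<..<1} b) \<partial>lborel)"
  proof (rule nn_integral_cong)
    fix b :: real
    show "ennreal (- ln (1 - b) / b) * indicator {0<..<1} b =
      (\<Sum>n. ennreal (b ^ n / real (n + 1)) * indicator {0<..<1} b)"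
    proof (cases "b \<in> {0<..<1}")
      case True
      then have "indicator {0<..<1} b = (1 :: ennreal)" by simp
      then show ?thesis by (simp only: series[OF True] mult_1_right)
    next
      case False
      then have "indicator {0<..<1} b = (0 :: ennreal)" by (simp only: indicator_simps not_False_eq_True)
      then show ?thesis by (simp only: mult_zero_right suminf_zero)
    qed
  qed
  also have "\<dots> = (\<Sum>n. ennreal (1 / (real n + 1)\<^sup>2))"
    by (subst nn_integral_suminf, measurable, simp only: monomial)
  also have "\<dots> = ennreal (pi\<^sup>2 / 6)"
    using inverse_squares_sums by (intro suminf_ennreal_eq) (auto simp: add.commute)
  finally show ?thesis .
qed

section \<open>The Haar measure of the canonical bases\<close>

definition wide_cell :: "real \<Rightarrow> (real^2^2) set" where
  "wide_cell T = {M \<in> cell. T < M$1$1 + M$2$1}"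

lemma wide_cell_borel [measurable]: "wide_cell T \<in> sets borel"
  unfolding wide_cell_def by measurable

text \<open>With \<open>\<beta> = - q\<close> and \<open>\<alpha> = s\<close> all coordinates of the cell are positive.\<close>

lemma haar_flipped:
  assumes [measurable]: "B \<in> sets borel"
  shows "haar (indicator B) = (\<integral>\<^sup>+\<beta>. \<integral>\<^sup>+\<alpha>. \<integral>\<^sup>+p.
      indicator B (mat2 p (- \<beta>) ((1 - p * \<alpha>) / \<beta>) \<alpha>) * ennreal (1 / \<bar>\<beta>\<bar>) \<partial>lborel \<partial>lborel \<partial>lborel)"
proof -
  let ?g = "\<lambda>q. \<integral>\<^sup>+s. \<integral>\<^sup>+p. indicator B (mat2 p q ((p * s - 1) / q) s) * ennreal (1 / \<bar>q\<bar>) \<partial>lborel \<partial>lborel"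
  have flip: "?g (- \<beta>) = (\<integral>\<^sup>+\<alpha>. \<integral>\<^sup>+p.
      indicator B (mat2 p (- \<beta>) ((1 - p * \<alpha>) / \<beta>) \<alpha>) * ennreal (1 / \<bar>\<beta>\<bar>) \<partial>lborel \<partial>lborel)" for \<beta>
  proof -
    have "(p * \<alpha> - 1) / (- \<beta>) = (1 - p * \<alpha>) / \<beta>" for p \<alpha>
      by (simp add: minus_divide_left)
    then show ?thesis by (simp only: abs_minus_cancel)
  qed
  have "haar (indicator B) = (\<integral>\<^sup>+q. ?g q \<partial>lborel)"
    by (rule haar_iterated) measurable
  also have "\<dots> = (\<integral>\<^sup>+\<beta>. ?g (- \<beta>) \<partial>lborel)"
    by (subst nn_integral_real_affine[where t=0 and c="-1"]) auto
  finally show ?thesis by (simp only: flip)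
qed

text \<open>For given heights \<open>\<alpha>\<close> and \<open>\<beta>\<close> the entry \<open>p = b\<close> runs through \<open>(0, 1 / \<alpha>)\<close>, so the cell has the measure of
  \<open>1 / (\<alpha> \<beta>)\<close> integrated over the triangle \<open>\<alpha>, \<beta> \<le> 1 < \<alpha> + \<beta>\<close>.\<close>

lemma haar_cell: "haar (indicator cell) = ennreal (pi\<^sup>2 / 6)"
proof -
  have inner: "(\<integral>\<^sup>+p. indicator cell (mat2 p (- \<beta>) ((1 - p * \<alpha>) / \<beta>) \<alpha>) * ennreal (1 / \<bar>\<beta>\<bar>) \<partial>lborel) =
      ennreal (1 / \<beta>) * (ennreal (1 / (\<alpha> - 0)) * indicator {1 - \<beta><..1} \<alpha>) * indicator {0<..<1} \<beta>"
    if "\<beta> \<noteq> 1" for \<alpha> \<beta> :: real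
  proof (cases "0 < \<beta> \<and> \<beta> < 1 \<and> 1 - \<beta> < \<alpha> \<and> \<alpha> \<le> 1")
    case True
    then have "\<alpha> > 0" by linarith
    have "indicator cell (mat2 p (- \<beta>) ((1 - p * \<alpha>) / \<beta>) \<alpha>) * ennreal (1 / \<bar>\<beta>\<bar>) =
        ennreal (1 / \<beta>) * indicator {0<..<1/\<alpha>} p" for p
      using True \<open>\<alpha> > 0\<close> by (auto simp: indicator_def cell_def field_simps)
    then have "(\<integral>\<^sup>+p. indicator cell (mat2 p (- \<beta>) ((1 - p * \<alpha>) / \<beta>) \<alpha>) * ennreal (1 / \<bar>\<beta>\<bar>) \<partial>lborel) =
       ennreal (1 / \<beta>) * emeasure lborel {0<..<1/\<alpha>}"
      by (simp only:) (rule nn_integral_cmult_indicator, simp)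
    also have "emeasure lborel {0<..<1/\<alpha>} = ennreal (1 / \<alpha>)"
      using \<open>\<alpha> > 0\<close> by simp
    finally show ?thesis using True by simp
  next
    case False
    then have "indicator cell (mat2 p (- \<beta>) ((1 - p * \<alpha>) / \<beta>) \<alpha>) = (0 :: ennreal)" for p
      using that by (auto simp: indicator_def cell_def)
    moreover have "indicator {1 - \<beta><..1} \<alpha> * indicator {0<..<1} \<beta> = (0 :: ennreal)"
      using False by (auto simp: indicator_def)
    ultimately show ?thesis by (simp add: mult.assoc)
  qed
  have "haar (indicator cell) = (\<integral>\<^sup>+\<beta>. \<integral>\<^sup>+\<alpha>. ennreal (1 / \<beta>) *
      (ennreal (1 / (\<alpha> - 0)) * indicator {1 - \<beta><..1} \<alpha>) * indicator {0<..<1} \<beta> \<partial>lborel \<partial>lborel)"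
    unfolding haar_flipped[OF cell_borel]
    by (rule nn_integral_cong_AE, use AE_lborel_singleton[of "1::real"] in eventually_elim)
       (simp only: inner not_False_eq_True)
  also have "\<dots> = (\<integral>\<^sup>+\<beta>. ennreal (1 / \<beta>) * (\<integral>\<^sup>+\<alpha>.
      ennreal (1 / (\<alpha> - 0)) * indicator {1 - \<beta><..1} \<alpha> \<partial>lborel) * indicator {0<..<1} \<beta> \<partial>lborel)"
    by (intro nn_integral_cong) (simp add: nn_integral_multc nn_integral_cmult)
  also have "\<dots> = (\<integral>\<^sup>+\<beta>. ennreal (- ln (1 - \<beta>) / \<beta>) * indicator {0<..<1} \<beta> \<partial>lborel)"
  proof (rule nn_integral_cong)
    fix \<beta> :: real
    show "ennreal (1 / \<beta>) * (\<integral>\<^sup>+\<alpha>. ennreal (1 / (\<alpha> - 0)) * indicator {1 - \<beta><..1} \<alpha> \<partial>lborel) *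
        indicator {0<..<1} \<beta> = ennreal (- ln (1 - \<beta>) / \<beta>) * indicator {0<..<1} \<beta>"
    proof (cases "\<beta> \<in> {0<..<1}")
      case True
      have "(\<integral>\<^sup>+\<alpha>. ennreal (1 / (\<alpha> - 0)) * indicator {1 - \<beta><..1} \<alpha> \<partial>lborel) = ennreal (- ln (1 - \<beta>))"
        using True by (subst inner_log_integral) auto
      then show ?thesis using True by (simp add: ennreal_mult[symmetric])
    qed simp
  qed
  also have "\<dots> = ennreal (pi\<^sup>2 / 6)" by (rule basel_integral)
  finally show ?thesis .
qed

text \<open>The density of Haar measure on the cell in the coordinates \<open>\<alpha>\<close>, \<open>\<beta>\<close> and \<open>t = a + b\<close>. On the segment of
  positive solutions of \<open>a \<beta> + b \<alpha> = 1\<close> the sum \<open>a + b\<close> lies between \<open>1 / \<alpha>\<close> and \<open>1 / \<beta>\<close>.\<close>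

definition slab :: "real \<Rightarrow> real \<Rightarrow> real \<Rightarrow> ennreal" where
  "slab t \<beta> \<alpha> = (if 0 < \<alpha> \<and> \<alpha> \<le> 1 \<and> 0 < \<beta> \<and> \<beta> \<le> 1 \<and> 1 < \<alpha> + \<beta> \<and> 
      (\<alpha> < 1 / t \<and> 1 / t < \<beta> \<or> \<beta> < 1 / t \<and> 1 / t < \<alpha>) then ennreal (1 / \<bar>\<beta> - \<alpha>\<bar>) else 0)"

lemma measurable_slab [measurable]:
  assumes [measurable]: "f \<in> borel_measurable M" "g \<in> borel_measurable M" "h \<in> borel_measurable M"
  shows "(\<lambda>x. slab (f x) (g x) (h x)) \<in> borel_measurable M"
  unfolding slab_def by measurable

text \<open>The slab consists of two halves that are exchanged with \<open>\<alpha>\<close> and \<open>\<beta>\<close>. For \<open>t \<le> 1\<close> it is empty.\<close>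

lemma slab_integral:
  assumes "0 < t"
  shows "(\<integral>\<^sup>+\<beta>. \<integral>\<^sup>+\<alpha>. slab t \<beta> \<alpha> \<partial>lborel \<partial>lborel) = ennreal (width_density t)"
proof (cases "t \<le> 1")
  case True
  have "1 \<le> 1 / t" using True assms by simp
  then have "slab t \<beta> \<alpha> = 0" for \<alpha> \<beta>
    by (auto simp: slab_def)
  then show ?thesis using True by (simp add: width_density_def)
next
  case False
  let ?\<tau> = "1 / t"
  have \<tau>: "0 < ?\<tau>" "?\<tau> < 1" using False by auto
  let ?h = "\<lambda>a b. (ennreal (1 / (b - a)) * indicator {max ?\<tau> (1 - a)<..1} b) * indicator {0<..<?\<tau>} a"
  have [measurable]: "(\<lambda>(x, y). ?h x y) \<in> borel_measurable (borel \<Otimes>\<^sub>M borel)"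
  proof -
    have "(\<lambda>(a, b). ?h a b) = (\<lambda>(a, b). if max ?\<tau> (1 - a) < b \<and> b \<le> 1 \<and> 0 < a \<and> a < ?\<tau> then ennreal (1 / (b - a)) else 0)"
      by (auto simp: indicator_def fun_eq_iff)
    also have "\<dots> \<in> borel_measurable (borel \<Otimes>\<^sub>M borel)" by measurable
    finally show ?thesis .
  qed
  have half: "(\<integral>\<^sup>+a. \<integral>\<^sup>+b. ?h a b \<partial>lborel \<partial>lborel) = ennreal (xlog (1 - ?\<tau>) + xlog (2 * ?\<tau> - 1) / 2)"
    by (subst half_width_density_integral[OF \<tau>, symmetric], intro nn_integral_cong) (simp add: nn_integral_multc)
  have split: "slab t \<beta> \<alpha> = ?h \<alpha> \<beta> + ?h \<beta> \<alpha>" for \<alpha> \<beta>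
    using \<tau> by (auto simp: slab_def indicator_def)
  have "(\<integral>\<^sup>+\<beta>. \<integral>\<^sup>+\<alpha>. slab t \<beta> \<alpha> \<partial>lborel \<partial>lborel) =
      (\<integral>\<^sup>+\<beta>. (\<integral>\<^sup>+\<alpha>. ?h \<alpha> \<beta> \<partial>lborel) + (\<integral>\<^sup>+\<alpha>. ?h \<beta> \<alpha> \<partial>lborel) \<partial>lborel)"
    unfolding split by (intro nn_integral_cong nn_integral_add) measurable
  also have "\<dots> = (\<integral>\<^sup>+\<beta>. \<integral>\<^sup>+\<alpha>. ?h \<alpha> \<beta> \<partial>lborel \<partial>lborel) + (\<integral>\<^sup>+\<beta>. \<integral>\<^sup>+\<alpha>. ?h \<beta> \<alpha> \<partial>lborel \<partial>lborel)"
    by (intro nn_integral_add) measurable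
  also have "(\<integral>\<^sup>+\<beta>. \<integral>\<^sup>+\<alpha>. ?h \<alpha> \<beta> \<partial>lborel \<partial>lborel) = (\<integral>\<^sup>+\<alpha>. \<integral>\<^sup>+\<beta>. ?h \<alpha> \<beta> \<partial>lborel \<partial>lborel)"
    by (rule swap_inner) measurable
  also have "(\<integral>\<^sup>+\<alpha>. \<integral>\<^sup>+\<beta>. ?h \<alpha> \<beta> \<partial>lborel \<partial>lborel) + (\<integral>\<^sup>+\<beta>. \<integral>\<^sup>+\<alpha>. ?h \<beta> \<alpha> \<partial>lborel \<partial>lborel) = 
      ennreal (xlog (1 - ?\<tau>) + xlog (2 * ?\<tau> - 1) / 2) + ennreal (xlog (1 - ?\<tau>) + xlog (2 * ?\<tau> - 1) / 2)"
    by (simp only: half)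
  also have "\<dots> = ennreal (width_density t)"
    using False half_width_density_nonneg[OF \<tau>] by (subst ennreal_plus[symmetric]) (auto simp: width_density_def)
  finally show ?thesis .
qed

text \<open>Solving \<open>p + (1 - p \<alpha>) / \<beta> = t\<close> for \<open>p\<close> gives an affine function of \<open>t\<close> with slope \<open>\<beta> / (\<beta> - \<alpha>)\<close>.\<close>

lemma width_substitution:
  assumes "\<alpha> \<noteq> \<beta>" "\<beta> \<noteq> 0" "0 < T"
  shows "(\<integral>\<^sup>+p. indicator (wide_cell T) (mat2 p (- \<beta>) ((1 - p * \<alpha>) / \<beta>) \<alpha>) * ennreal (1 / \<bar>\<beta>\<bar>) \<partial>lborel)
    = (\<integral>\<^sup>+t. indicator {T<..} t * slab t \<beta> \<alpha> \<partial>lborel)" (is "?L = ?R")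
proof -
  let ?p = "\<lambda>t. - 1 / (\<beta> - \<alpha>) + \<beta> / (\<beta> - \<alpha>) * t"
  let ?f = "\<lambda>p. indicator (wide_cell T) (mat2 p (- \<beta>) ((1 - p * \<alpha>) / \<beta>) \<alpha>) * ennreal (1 / \<bar>\<beta>\<bar>)"
  have "?L = ennreal \<bar>\<beta> / (\<beta> - \<alpha>)\<bar> * (\<integral>\<^sup>+t. ?f (?p t) \<partial>lborel)"
    by (rule nn_integral_real_affine) (use assms in auto)
  also have "\<dots> = (\<integral>\<^sup>+t. ennreal \<bar>\<beta> / (\<beta> - \<alpha>)\<bar> * ?f (?p t) \<partial>lborel)"
    by (rule nn_integral_cmult[symmetric]) auto
  also have "\<dots> = ?R"
  proof (rule nn_integral_cong)
    fix t :: real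
    have p: "?p t = (t * \<beta> - 1) / (\<beta> - \<alpha>)" by (simp add: field_simps diff_divide_distrib)
    have "1 - (t * \<beta> - 1) / (\<beta> - \<alpha>) * \<alpha> = \<beta> * (1 - t * \<alpha>) / (\<beta> - \<alpha>)"
      using assms by (simp add: divide_simps) (simp add: algebra_simps)
    then have r: "(1 - ?p t * \<alpha>) / \<beta> = (1 - t * \<alpha>) / (\<beta> - \<alpha>)"
      unfolding p using assms by simp
    have t: "(t * \<beta> - 1) / (\<beta> - \<alpha>) + (1 - t * \<alpha>) / (\<beta> - \<alpha>) = t"
      unfolding add_divide_distrib[symmetric] using assms by (simp add: divide_eq_eq algebra_simps)
    have e: "ennreal \<bar>\<beta> / (\<beta> - \<alpha>)\<bar> * ennreal (1 / \<bar>\<beta>\<bar>) = ennreal (1 / \<bar>\<beta> - \<alpha>\<bar>)"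
      using assms by (subst ennreal_mult[symmetric]) auto
    have mem: "mat2 (?p t) (- \<beta>) ((1 - ?p t * \<alpha>) / \<beta>) \<alpha> \<in> wide_cell T \<longleftrightarrow>
       T < t \<and> 0 < \<alpha> \<and> \<alpha> \<le> 1 \<and> 0 < \<beta> \<and> \<beta> \<le> 1 \<and> 1 < \<alpha> + \<beta> \<and>
       0 < (t * \<beta> - 1) / (\<beta> - \<alpha>) \<and> 0 < (1 - t * \<alpha>) / (\<beta> - \<alpha>)"
      unfolding r unfolding p by (auto simp: wide_cell_def cell_def t)
    have sgn: "0 < (t * \<beta> - 1) / (\<beta> - \<alpha>) \<and> 0 < (1 - t * \<alpha>) / (\<beta> - \<alpha>) \<longleftrightarrow>
      (\<alpha> < 1 / t \<and> 1 / t < \<beta> \<or> \<beta> < 1 / t \<and> 1 / t < \<alpha>)" if "T < t" "0 < \<alpha>" "0 < \<beta>"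
    proof -
      have "0 < t" using that assms by linarith
      have "\<alpha> < 1 / t \<longleftrightarrow> t * \<alpha> < 1" "1 / t < \<beta> \<longleftrightarrow> 1 < t * \<beta>"
        "\<beta> < 1 / t \<longleftrightarrow> t * \<beta> < 1" "1 / t < \<alpha> \<longleftrightarrow> 1 < t * \<alpha>"
        using \<open>0 < t\<close> by (simp_all add: less_divide_eq divide_less_eq mult.commute)
      moreover have "t * \<alpha> < t * \<beta> \<longleftrightarrow> \<alpha> < \<beta>" using \<open>0 < t\<close> by simp
      ultimately show ?thesis by (auto simp: zero_less_divide_iff)
    qed
    have "mat2 (?p t) (- \<beta>) ((1 - ?p t * \<alpha>) / \<beta>) \<alpha> \<in> wide_cell T \<longleftrightarrow>
       T < t \<and> 0 < \<alpha> \<and> \<alpha> \<le> 1 \<and> 0 < \<beta> \<and> \<beta> \<le> 1 \<and> 1 < \<alpha> + \<beta> \<and> 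
      (\<alpha> < 1 / t \<and> 1 / t < \<beta> \<or> \<beta> < 1 / t \<and> 1 / t < \<alpha>)"
      unfolding mem using sgn by blast
    then show "ennreal \<bar>\<beta> / (\<beta> - \<alpha>)\<bar> * ?f (?p t) = indicator {T<..} t * slab t \<beta> \<alpha>"
      unfolding slab_def e[symmetric] by (simp add: indicator_def mult_ac)
  qed
  finally show ?thesis .
qed

lemma haar_wide_cell:
  assumes "0 < T"
  shows "haar (indicator (wide_cell T)) = (\<integral>\<^sup>+t. ennreal (width_density t) * indicator {T<..} t \<partial>lborel)"
proof -
  have "haar (indicator (wide_cell T)) = (\<integral>\<^sup>+\<beta>. \<integral>\<^sup>+\<alpha>. \<integral>\<^sup>+t. indicator {T<..} t * slab t \<beta> \<alpha> \<partial>lborel \<partial>lborel \<partial>lborel)"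
    unfolding haar_flipped[OF wide_cell_borel]
  proof (rule nn_integral_cong_AE, use AE_lborel_singleton[of "0::real"] in eventually_elim)
    case (elim \<beta>)
    show ?case
      by (rule nn_integral_cong_AE, use AE_lborel_singleton[of \<beta>] in eventually_elim)
         (use elim assms in \<open>simp only: width_substitution not_False_eq_True\<close>)
  qed
  also have "\<dots> = (\<integral>\<^sup>+\<beta>. \<integral>\<^sup>+t. \<integral>\<^sup>+\<alpha>. indicator {T<..} t * slab t \<beta> \<alpha> \<partial>lborel \<partial>lborel \<partial>lborel)"
    by (intro nn_integral_cong swap_inner) measurable
  also have "\<dots> = (\<integral>\<^sup>+t. \<integral>\<^sup>+\<beta>. \<integral>\<^sup>+\<alpha>. indicator {T<..} t * slab t \<beta> \<alpha> \<partial>lborel \<partial>lborel \<partial>lborel)"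
    by (rule swap_inner) measurable
  also have "\<dots> = (\<integral>\<^sup>+t. indicator {T<..} t * (\<integral>\<^sup>+\<beta>. \<integral>\<^sup>+\<alpha>. slab t \<beta> \<alpha> \<partial>lborel \<partial>lborel) \<partial>lborel)"
    by (simp add: nn_integral_cmult)
  also have "\<dots> = (\<integral>\<^sup>+t. ennreal (width_density t) * indicator {T<..} t \<partial>lborel)"
    using assms by (intro nn_integral_cong) (auto simp: indicator_def slab_integral)
  finally show ?thesis .
qed

lemma haar_cong_SL2R:
  assumes "\<And>M. M \<in> SL2R \<Longrightarrow> f M = g M" 
    and [measurable]: "f \<in> borel_measurable borel" "g \<in> borel_measurable borel"
  shows "haar f = haar g"
proof -
  have *: "f (mat2 p q ((p * s - 1) / q) s) = g (mat2 p q ((p * s - 1) / q) s)" if "q \<noteq> 0" for p q s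
    by (rule assms(1)) (use that in \<open>simp add: SL2R_det\<close>)
  show ?thesis
    by (subst (1 2) haar_iterated; (measurable)?)
       (intro nn_integral_cong_AE, use AE_lborel_singleton[of "0::real"] in eventually_elim, simp add: *)
qed

text \<open>From \<open>b \<alpha> + a \<beta> = 1\<close> and \<open>\<alpha>, \<beta> \<le> 1\<close> it follows that \<open>a + b \<ge> 1\<close>.\<close>

lemma wide_cell_small:
  assumes "M \<in> SL2R" "M \<in> cell" "T < 1"
  shows "M \<in> wide_cell T"
proof -
  have "M$1$1 * M$2$2 \<le> M$1$1 * 1" "(- (M$1$2)) * M$2$1 \<le> 1 * M$2$1"
    using assms(2) unfolding cell_def by (intro mult_left_mono mult_right_mono; simp)+
  then show ?thesis using assms by (simp add: wide_cell_def SL2R_det)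
qed

text \<open>For \<open>T < 1\<close> the wide cell agrees with the cell on \<open>SL(2, \<real>)\<close>, so the measure of the cell,
  \<open>pi\<^sup>2 / 6\<close>, is the total
  integral of the density. The tail integral is expressed by its complement, whose upper limit is the
  variable of differentiation. The lower limit \<open>-1\<close> only serves to have \<open>T = 0\<close> in the interior; the density vanishes
  below \<open>1\<close>.\<close>

lemma haar_wide_cell_eq:
  assumes "0 < T"
  shows "haar (indicator (wide_cell T)) = ennreal (pi\<^sup>2 / 6 - integral {-1..T} width_density)"
    "integral {-1..T} width_density \<le> pi\<^sup>2 / 6"
proof -
  have total: "(\<integral>\<^sup>+t. ennreal (width_density t) \<partial>lborel) = ennreal (pi\<^sup>2 / 6)"
  proof -
    have "(\<integral>\<^sup>+t. ennreal (width_density t) \<partial>lborel) = (\<integral>\<^sup>+t. ennreal (width_density t) * indicator {1/2<..} t \<partial>lborel)"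
      by (intro nn_integral_cong) (auto simp: indicator_def width_density_def)
    also have "\<dots> = haar (indicator (wide_cell (1/2)))" by (subst haar_wide_cell) auto
    also have "\<dots> = haar (indicator cell)"
      by (rule haar_cong_SL2R) (auto simp: indicator_def wide_cell_small, simp add: wide_cell_def)
    finally show ?thesis by (simp add: haar_cell)
  qed
  have part: "(\<integral>\<^sup>+t. ennreal (width_density t) * indicator {-1..T} t \<partial>lborel) = ennreal (integral {-1..T} width_density)"
    by (rule nn_integral_has_integral_lebesgue')
       (auto intro!: width_density_nonneg integrable_integral integrable_continuous_interval continuous_on_width_density)
  have "(\<integral>\<^sup>+t. ennreal (width_density t) \<partial>lborel) =
      (\<integral>\<^sup>+t. ennreal (width_density t) * indicator {-1..T} t + ennreal (width_density t) * indicator {T<..} t \<partial>lborel)"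
    using assms by (intro nn_integral_cong) (auto simp: indicator_def width_density_def)
  also have "\<dots> = ennreal (integral {-1..T} width_density) + haar (indicator (wide_cell T))"
    by (subst nn_integral_add) (auto simp: part haar_wide_cell[OF assms])
  finally have sum: "ennreal (integral {-1..T} width_density) + haar (indicator (wide_cell T)) = ennreal (pi\<^sup>2 / 6)"
    by (simp add: total)
  have nonneg: "0 \<le> integral {-1..T} width_density"
    by (rule integral_nonneg) (auto intro!: width_density_nonneg integrable_continuous_interval continuous_on_width_density)
  have "ennreal (integral {-1..T} width_density) \<le> ennreal (pi\<^sup>2 / 6)"
    unfolding sum[symmetric] by simp
  then show le: "integral {-1..T} width_density \<le> pi\<^sup>2 / 6" by (simp add: ennreal_le_iff)
  have "haar (indicator (wide_cell T)) = (ennreal (integral {-1..T} width_density) + haar (indicator (wide_cell T))) -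
      ennreal (integral {-1..T} width_density)"
    by simp
  also have "\<dots> = ennreal (pi\<^sup>2 / 6 - integral {-1..T} width_density)"
    unfolding sum using nonneg by (rule ennreal_minus)
  finally show "haar (indicator (wide_cell T)) = ennreal (pi\<^sup>2 / 6 - integral {-1..T} width_density)" .
qed

definition axis_vector_bases :: "(real^2^2) set" where
  "axis_vector_bases = {M. \<exists>(m::int) (n::int). (m, n) \<noteq> (0, 0) \<and>
      (of_int m * M$1$1 + of_int n * M$2$1 = 0 \<or> of_int m * M$1$2 + of_int n * M$2$2 = 0)}"

lemma axis_vector_bases_borel [measurable]: "axis_vector_bases \<in> sets borel"
  unfolding axis_vector_bases_def by measurable

text \<open>For given integers \<open>m\<close>, \<open>n\<close> and almost all \<open>q\<close>, \<open>s\<close> the height of the combination is not zero, and then its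
  horizontal coordinate vanishes for a single value of \<open>p\<close> only.\<close>

lemma haar_axis_vector_bases: "haar (indicator axis_vector_bases) = 0"
proof -
  let ?N = axis_vector_bases
  have s: "AE s in lborel. \<forall>(m::int) (n::int). (m, n) \<noteq> (0, 0) \<longrightarrow> of_int m * q + of_int n * s \<noteq> 0" if "q \<noteq> 0" for q :: real
    unfolding AE_all_countable
  proof (intro allI)
    fix m n :: int
    show "AE s in lborel. (m, n) \<noteq> (0, 0) \<longrightarrow> of_int m * q + of_int n * s \<noteq> 0"
    proof (cases "n = 0")
      case False
      show ?thesis
        using AE_lborel_singleton[of "- (of_int m * q) / of_int n"]
        by eventually_elim (use False in \<open>auto simp: field_simps\<close>)
    qed (use that in auto)
  qed
  have p: "AE p in lborel. \<forall>(m::int) (n::int). (m, n) \<noteq> (0, 0) \<longrightarrow> of_int m * p + of_int n * ((p * s - 1) / q) \<noteq> 0"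
    if q: "q \<noteq> 0" and s: "\<forall>(m::int) (n::int). (m, n) \<noteq> (0, 0) \<longrightarrow> of_int m * q + of_int n * s \<noteq> 0" for q s :: real
    unfolding AE_all_countable
  proof (intro allI)
    fix m n :: int
    show "AE p in lborel. (m, n) \<noteq> (0, 0) \<longrightarrow> of_int m * p + of_int n * ((p * s - 1) / q) \<noteq> 0"
      using AE_lborel_singleton[of "of_int n / (of_int m * q + of_int n * s)"]
    proof eventually_elim
      case (elim p)
      show ?case
      proof (intro impI notI)
        assume mn: "(m, n) \<noteq> (0, 0)" and 0: "of_int m * p + of_int n * ((p * s - 1) / q) = 0"
        have "p * (of_int m * q + of_int n * s) = of_int n" using 0 q by (simp add: field_simps)
        then have "p = of_int n / (of_int m * q + of_int n * s)" using s mn by (simp add: eq_divide_eq)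
        then show False using elim by simp
      qed
    qed
  qed
  have "haar (indicator ?N) = (\<integral>\<^sup>+q. \<integral>\<^sup>+s. \<integral>\<^sup>+p. indicator ?N (mat2 p q ((p * s - 1) / q) s) *
      ennreal (1 / \<bar>q\<bar>) \<partial>lborel \<partial>lborel \<partial>lborel)"
    by (rule haar_iterated) measurable
  also have "\<dots> = (\<integral>\<^sup>+(q::real). \<integral>\<^sup>+(s::real). \<integral>\<^sup>+(p::real). 0 \<partial>lborel \<partial>lborel \<partial>lborel)"
  proof (rule nn_integral_cong_AE, use AE_lborel_singleton[of "0::real"] in eventually_elim)
    fix q :: real assume q: "q \<noteq> 0"
    show "(\<integral>\<^sup>+s. \<integral>\<^sup>+p. indicator ?N (mat2 p q ((p * s - 1) / q) s) * ennreal (1 / \<bar>q\<bar>) \<partial>lborel \<partial>lborel) =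
       (\<integral>\<^sup>+(s::real). \<integral>\<^sup>+(p::real). 0 \<partial>lborel \<partial>lborel)"
    proof (rule nn_integral_cong_AE, use s[OF q] in eventually_elim)
      fix s :: real assume s: "\<forall>(m::int) (n::int). (m, n) \<noteq> (0, 0) \<longrightarrow> of_int m * q + of_int n * s \<noteq> 0"
      show "(\<integral>\<^sup>+p. indicator ?N (mat2 p q ((p * s - 1) / q) s) * ennreal (1 / \<bar>q\<bar>) \<partial>lborel) =
         (\<integral>\<^sup>+(p::real). 0 \<partial>lborel)"
      proof (rule nn_integral_cong_AE, use p[OF q s] in eventually_elim)
        fix p :: real assume p: "\<forall>(m::int) (n::int). (m, n) \<noteq> (0, 0) \<longrightarrow> of_int m * p + of_int n * ((p * s - 1) / q) \<noteq> 0"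
        have "mat2 p q ((p * s - 1) / q) s \<notin> ?N" using p s unfolding axis_vector_bases_def by auto
        then show "indicator ?N (mat2 p q ((p * s - 1) / q) s) * ennreal (1 / \<bar>q\<bar>) = 0" by simp
      qed
    qed
  qed
  finally show ?thesis by simp
qed

lemma not_generic_axis:
  assumes "M \<in> SL2R" "\<not> generic (int_lattice M)"
  shows "M \<in> axis_vector_bases"
proof -
  obtain u where u: "u \<in> int_lattice M" "u \<noteq> 0" "u$1 = 0 \<or> u$2 = 0"
    using assms(2) by (auto simp: generic_def)
  obtain m n :: int where mn: "u$1 = m * M$1$1 + n * M$2$1" "u$2 = m * M$1$2 + n * M$2$2"
    using u(1) unfolding int_lattice_iff by blast
  have "(m, n) \<noteq> (0, 0)" using u(2) mn by (auto simp: vec_eq_iff forall_2)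
  then show ?thesis using u(3) unfolding mn axis_vector_bases_def by blast
qed

section \<open>Coverings and the covering radius\<close>

definition covers :: "real \<Rightarrow> (real^2) set \<Rightarrow> bool" where
  "covers r L \<longleftrightarrow> (\<lambda>x. r *\<^sub>R x) ` cross_polytope + L = UNIV"

lemma covers_iff:
  assumes "0 < r"
  shows "covers r L \<longleftrightarrow> (\<forall>z :: real^2. \<exists>u\<in>L. \<bar>z$1 - u$1\<bar> + \<bar>z$2 - u$2\<bar> \<le> r)"
proof -
  have scaled: "x \<in> (\<lambda>x. r *\<^sub>R x) ` cross_polytope \<longleftrightarrow> \<bar>x$1\<bar> + \<bar>x$2\<bar> \<le> r" for x
  proof
    assume "x \<in> (\<lambda>x. r *\<^sub>R x) ` cross_polytope"
    then obtain y where y: "x = r *\<^sub>R y" "\<bar>y$1\<bar> + \<bar>y$2\<bar> \<le> 1" by (auto simp: cross_polytope_def)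
    then have "r * (\<bar>y$1\<bar> + \<bar>y$2\<bar>) \<le> r * 1" using assms by (intro mult_left_mono) auto
    then show "\<bar>x$1\<bar> + \<bar>x$2\<bar> \<le> r"
      using assms y by (simp add: abs_mult distrib_left)
  next
    assume x: "\<bar>x$1\<bar> + \<bar>x$2\<bar> \<le> r"
    have "\<bar>((1/r) *\<^sub>R x)$1\<bar> + \<bar>((1/r) *\<^sub>R x)$2\<bar> = (\<bar>x$1\<bar> + \<bar>x$2\<bar>) / r"
      using assms by (simp add: abs_mult add_divide_distrib)
    also have "\<dots> \<le> 1" using x assms by simp
    finally have "(1/r) *\<^sub>R x \<in> cross_polytope" by (simp add: cross_polytope_def)
    then show "x \<in> (\<lambda>x. r *\<^sub>R x) ` cross_polytope"
      using assms by (intro image_eqI[of _ _ "(1/r) *\<^sub>R x"]) auto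
  qed
  have "z \<in> (\<lambda>x. r *\<^sub>R x) ` cross_polytope + L \<longleftrightarrow> (\<exists>u\<in>L. \<bar>z$1 - u$1\<bar> + \<bar>z$2 - u$2\<bar> \<le> r)" for z
  proof -
    have "z \<in> (\<lambda>x. r *\<^sub>R x) ` cross_polytope + L \<longleftrightarrow> (\<exists>u\<in>L. z - u \<in> (\<lambda>x. r *\<^sub>R x) ` cross_polytope)"
    proof
      assume "z \<in> (\<lambda>x. r *\<^sub>R x) ` cross_polytope + L"
      then obtain a u where "a \<in> (\<lambda>x. r *\<^sub>R x) ` cross_polytope" "u \<in> L" "z = a + u"
        by (rule set_plus_elim)
      then show "\<exists>u\<in>L. z - u \<in> (\<lambda>x. r *\<^sub>R x) ` cross_polytope"
        by (metis add_diff_cancel_right')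
    next
      assume "\<exists>u\<in>L. z - u \<in> (\<lambda>x. r *\<^sub>R x) ` cross_polytope"
      then obtain u where "u \<in> L" "z - u \<in> (\<lambda>x. r *\<^sub>R x) ` cross_polytope" by blast
      then have "(z - u) + u \<in> (\<lambda>x. r *\<^sub>R x) ` cross_polytope + L" by (intro set_plus_intro)
      then show "z \<in> (\<lambda>x. r *\<^sub>R x) ` cross_polytope + L" by simp
    qed
    then show ?thesis unfolding scaled by simp
  qed
  then show ?thesis unfolding covers_def by blast
qed

lemma covers_mono:
  assumes "covers r L" "0 < r" "r \<le> r'"
  shows "covers r' L"
proof -
  have "0 < r'" using assms by linarith
  show ?thesis
    using assms(1) order_trans[OF _ assms(3)]
    unfolding covers_iff[OF assms(2)] covers_iff[OF \<open>0 < r'\<close>] by meson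
qed

text \<open>Rounding down the coordinates of \<open>z\<close> with respect to a basis moves \<open>z\<close> by at most the sum of the absolute
  values of the entries.\<close>

lemma covers_exists:
  assumes "L \<in> X2"
  obtains r where "0 < r" "covers r L"
proof -
  obtain M where M: "M \<in> SL2R" "L = int_lattice M" using assms by (auto simp: X2_iff)
  define r where "r = (\<bar>M$1$1\<bar> + \<bar>M$2$1\<bar>) + (\<bar>M$1$2\<bar> + \<bar>M$2$2\<bar>) + 1"
  have "0 < r" unfolding r_def by linarith
  have "\<exists>u\<in>L. \<bar>z$1 - u$1\<bar> + \<bar>z$2 - u$2\<bar> \<le> r" for z :: "real^2"
  proof -
    define y where "y = z v* adj2 M"
    have z: "z = y v* M"
      by (simp add: y_def vector_matrix_mul_assoc adj2_inverse[OF M(1)])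
    define u where "u = of_int \<lfloor>y$1\<rfloor> *\<^sub>R M$1 + of_int \<lfloor>y$2\<rfloor> *\<^sub>R M$2"
    have rows: "M$i \<in> L" for i using row_in_int_lattice M by blast
    have uL: "u \<in> L" unfolding u_def by (rule lattice_comb[OF assms rows rows])
    have part: "\<bar>z$j - u$j\<bar> \<le> \<bar>M$1$j\<bar> + \<bar>M$2$j\<bar>" for j
    proof -
      have "z$j - u$j = frac (y$1) * M$1$j + frac (y$2) * M$2$j"
        by (simp add: z vmult_nth_2 u_def frac_def algebra_simps)
      also have "\<bar>\<dots>\<bar> \<le> \<bar>frac (y$1) * M$1$j\<bar> + \<bar>frac (y$2) * M$2$j\<bar>" by (rule abs_triangle_ineq)
      also have "\<dots> \<le> 1 * \<bar>M$1$j\<bar> + 1 * \<bar>M$2$j\<bar>"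
        unfolding abs_mult by (intro add_mono mult_right_mono) (auto intro: less_imp_le frac_lt_1)
      finally show ?thesis by simp
    qed
    have "\<bar>z$1 - u$1\<bar> + \<bar>z$2 - u$2\<bar> \<le> r"
      using add_mono[OF part[of 1] part[of 2]] unfolding r_def by linarith
    then show ?thesis using uL by blast
  qed
  then show ?thesis using that[of r] \<open>0 < r\<close> by (simp add: covers_iff)
qed

lemma covering_radius_le:
  assumes "0 < r" "covers r L"
  shows "covering_radius cross_polytope L \<le> r"
  unfolding covering_radius_def
  by (rule cInf_lower) (use assms in \<open>auto simp: covers_def intro!: bdd_belowI[of _ 0]\<close>)

lemma covering_radius_ge:
  assumes "L \<in> X2" "0 < r" "\<not> covers r L"
  shows "r \<le> covering_radius cross_polytope L"
  unfolding covering_radius_def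
proof (rule cInf_greatest)
  obtain s where "0 < s" "covers s L" using covers_exists[OF assms(1)] .
  then show "{r. 0 < r \<and> (\<lambda>x. r *\<^sub>R x) ` cross_polytope + L = UNIV} \<noteq> {}"
    unfolding covers_def by blast
  fix s assume "s \<in> {r. 0 < r \<and> (\<lambda>x. r *\<^sub>R x) ` cross_polytope + L = UNIV}"
  then have "0 < s" "covers s L" unfolding covers_def by blast+
  then show "r \<le> s" using covers_mono[of s L r] assms(3) by linarith
qed

lemma covering_radius_gt_iff:
  assumes "L \<in> X2" "0 \<le> R"
  shows "R < covering_radius cross_polytope L \<longleftrightarrow> (\<exists>r>R. \<not> covers r L)"
proof
  assume "R < covering_radius cross_polytope L"
  then obtain r where "R < r" "r < covering_radius cross_polytope L" using dense by blast
  moreover from this have "\<not> covers r L"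
    using covering_radius_le[of r L] assms(2) by auto
  ultimately show "\<exists>r>R. \<not> covers r L" by blast
next
  assume "\<exists>r>R. \<not> covers r L"
  then obtain r where r: "R < r" "\<not> covers r L" by blast
  then have "r \<le> covering_radius cross_polytope L"
    using assms by (intro covering_radius_ge) auto
  then show "R < covering_radius cross_polytope L" using r by linarith
qed

text \<open>An uncovered point leaves room for a rational point and a slightly smaller rational radius. In this
  form the condition is countable in the entries of a basis, hence Borel.\<close>

lemma covering_radius_gt_rational:
  assumes "L \<in> X2" "0 \<le> R"
  shows "R < covering_radius cross_polytope L \<longleftrightarrow>
    (\<exists>r x y :: rat. R < of_rat r \<and> (\<forall>u\<in>L. of_rat r < \<bar>of_rat x - u$1\<bar> + \<bar>of_rat y - u$2\<bar>))"
proof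
  assume "R < covering_radius cross_polytope L"
  then obtain r where r: "R < r" "\<not> covers r L" using covering_radius_gt_iff[OF assms] by blast
  moreover have "0 < r" using r assms(2) by linarith
  ultimately obtain z :: "real^2" where z: "\<And>u. u \<in> L \<Longrightarrow> r < \<bar>z$1 - u$1\<bar> + \<bar>z$2 - u$2\<bar>"
    unfolding covers_iff[OF \<open>0 < r\<close>] by (meson not_le)
  obtain \<rho> :: rat where \<rho>: "R < of_rat \<rho>" "of_rat \<rho> < r" using of_rat_dense[OF r(1)] by blast
  define e where "e = (r - of_rat \<rho>) / 2"
  have "e > 0" using \<rho> by (simp add: e_def)
  obtain x :: rat where x: "z$1 - e < of_rat x" "of_rat x < z$1"
    using of_rat_dense[of "z$1 - e" "z$1"] \<open>e > 0\<close> by auto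
  obtain y :: rat where y: "z$2 - e < of_rat y" "of_rat y < z$2"
    using of_rat_dense[of "z$2 - e" "z$2"] \<open>e > 0\<close> by auto
  have "of_rat \<rho> < \<bar>of_rat x - u$1\<bar> + \<bar>of_rat y - u$2\<bar>" if "u \<in> L" for u
  proof -
    have "\<bar>z$1 - u$1\<bar> \<le> \<bar>of_rat x - u$1\<bar> + e" "\<bar>z$2 - u$2\<bar> \<le> \<bar>of_rat y - u$2\<bar> + e"
      using x y by linarith+
    then show ?thesis using z[OF that] unfolding e_def by (simp add: field_simps)
  qed
  then show "\<exists>r x y :: rat. R < of_rat r \<and> (\<forall>u\<in>L. of_rat r < \<bar>of_rat x - u$1\<bar> + \<bar>of_rat y - u$2\<bar>)"
    using \<rho>(1) by blast
next
  assume "\<exists>r x y :: rat. R < of_rat r \<and> (\<forall>u\<in>L. of_rat r < \<bar>of_rat x - u$1\<bar> + \<bar>of_rat y - u$2\<bar>)"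
  then obtain r x y :: rat where r: "R < of_rat r"
    and u: "\<And>u. u \<in> L \<Longrightarrow> of_rat r < \<bar>of_rat x - u$1\<bar> + \<bar>of_rat y - u$2\<bar>" by blast
  have "\<not> covers (of_rat r) L"
  proof
    assume "covers (of_rat r) L"
    moreover have "0 < (of_rat r :: real)" using r assms(2) by linarith
    ultimately have "\<exists>u\<in>L. \<bar>(vector [of_rat x, of_rat y] :: real^2)$1 - u$1\<bar> +
        \<bar>(vector [of_rat x, of_rat y] :: real^2)$2 - u$2\<bar> \<le> of_rat r"
      by (simp only: covers_iff)
    then show False unfolding vector_2 using u by (meson not_le)
  qed
  then show "R < covering_radius cross_polytope L" using covering_radius_gt_iff[OF assms] r by blast
qed

lemma covering_radius_gt_measurable:
  assumes "0 \<le> R"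
  shows "{L \<in> X2. R < covering_radius cross_polytope L} \<in> sets X2_borel"
proof (rule X2_borel_if_borel_preimage)
  let ?far = "\<lambda>(r::rat) (x::rat) (y::rat) M. \<forall>(m::int) (n::int).
     of_rat r < \<bar>of_rat x - (m * M$1$1 + n * M$2$1)\<bar> + \<bar>of_rat y - (m * M$1$2 + n * (M :: real^2^2)$2$2)\<bar>"
  have ball: "(\<forall>u\<in>int_lattice M. P (u$1) (u$2)) \<longleftrightarrow>
      (\<forall>(m::int) (n::int). P (m * M$1$1 + n * M$2$1) (m * M$1$2 + n * M$2$2))" for P M
  proof
    assume P: "\<forall>u\<in>int_lattice M. P (u$1) (u$2)"
    show "\<forall>(m::int) (n::int). P (m * M$1$1 + n * M$2$1) (m * M$1$2 + n * M$2$2)"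
    proof (intro allI)
      fix m n :: int
      let ?u = "vector [m * M$1$1 + n * M$2$1, m * M$1$2 + n * M$2$2] :: real^2"
      have "?u \<in> int_lattice M" unfolding int_lattice_iff by (intro exI[of _ m] exI[of _ n]) simp
      then have "P (?u$1) (?u$2)" using P by blast
      then show "P (m * M$1$1 + n * M$2$1) (m * M$1$2 + n * M$2$2)" by simp
    qed
  qed (auto simp: int_lattice_iff)
  have "{M \<in> SL2R. int_lattice M \<in> {L \<in> X2. R < covering_radius cross_polytope L}} =
      SL2R \<inter> {M. \<exists>r x y. R < of_rat r \<and> ?far r x y M}"
    using covering_radius_gt_rational[OF int_lattice_in_X2 assms]
    by (auto simp: int_lattice_in_X2 ball[where P="\<lambda>a b. _ < \<bar>_ - a\<bar> + \<bar>_ - b\<bar>"])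
  also have "\<dots> \<in> sets borel" by measurable
  finally show "{M \<in> SL2R. int_lattice M \<in> {L \<in> X2. R < covering_radius cross_polytope L}} \<in> sets borel" .
qed auto

text \<open>This matrix maps \<open>(x\<^sub>1, x\<^sub>2)\<close> to \<open>(R (x\<^sub>1 + x\<^sub>2), (x\<^sub>2 - x\<^sub>1) / (2 R))\<close>. It therefore maps the diamond of radius
  \<open>R\<close> onto the box with half-sides \<open>R\<^sup>2\<close> and \<open>1 / 2\<close>.\<close>

definition box_frame :: "real \<Rightarrow> real^2^2" where
  "box_frame R = mat2 R (- 1 / (2 * R)) R (1 / (2 * R))"

lemma box_frame_SL2R: "R \<noteq> 0 \<Longrightarrow> box_frame R \<in> SL2R"
  by (simp add: SL2R_det box_frame_def)

lemma covers_iff_box_covers: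
  assumes "0 < R"
  shows "covers R L \<longleftrightarrow> box_covers (2 * R^2) (lattice_act (box_frame R) L)"
proof -
  let ?A = "box_frame R"
  have A: "?A \<in> SL2R" using assms by (intro box_frame_SL2R) simp
  have norm: "\<bar>(z v* ?A)$1 - (u v* ?A)$1\<bar> \<le> 2 * R^2 / 2 \<and> \<bar>(z v* ?A)$2 - (u v* ?A)$2\<bar> \<le> 1/2 \<longleftrightarrow>
     \<bar>z$1 - u$1\<bar> + \<bar>z$2 - u$2\<bar> \<le> R" for z u :: "real^2"
  proof -
    have 1: "(z v* ?A)$1 - (u v* ?A)$1 = R * ((z$1 - u$1) + (z$2 - u$2))"
      by (simp add: box_frame_def vmult_nth_2 algebra_simps)
    have 2: "(z v* ?A)$2 - (u v* ?A)$2 = ((z$2 - u$2) - (z$1 - u$1)) / (2 * R)"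
      using assms by (simp add: box_frame_def vmult_nth_2 field_simps)
    have "\<bar>R * s\<bar> \<le> 2 * R^2 / 2 \<longleftrightarrow> \<bar>s\<bar> \<le> R" for s
      using assms by (simp add: abs_mult power2_eq_square)
    moreover have "\<bar>d / (2 * R)\<bar> \<le> 1/2 \<longleftrightarrow> \<bar>d\<bar> \<le> R" for d
      using assms by (simp add: abs_divide divide_le_eq)
    moreover have "\<bar>x + y\<bar> \<le> R \<and> \<bar>y - x\<bar> \<le> R \<longleftrightarrow> \<bar>x\<bar> + \<bar>y\<bar> \<le> R" for x y :: real
      by linarith
    ultimately show ?thesis unfolding 1 2 by simp
  qed
  have "box_covers (2 * R^2) (lattice_act ?A L) \<longleftrightarrow> (\<forall>z :: real^2. \<exists>u\<in>L. 
      \<bar>(z v* ?A)$1 - (u v* ?A)$1\<bar> \<le> 2 * R^2 / 2 \<and> \<bar>(z v* ?A)$2 - (u v* ?A)$2\<bar> \<le> 1/2)"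
  proof -
    have surj: "z = (z v* adj2 ?A) v* ?A" for z
      by (simp add: vector_matrix_mul_assoc adj2_inverse[OF A])
    show ?thesis
    proof
      assume "box_covers (2 * R^2) (lattice_act ?A L)"
      then show "\<forall>z :: real^2. \<exists>u\<in>L. 
        \<bar>(z v* ?A)$1 - (u v* ?A)$1\<bar> \<le> 2 * R^2 / 2 \<and> \<bar>(z v* ?A)$2 - (u v* ?A)$2\<bar> \<le> 1/2"
        unfolding box_covers_def lattice_act_def by blast
    next
      assume *: "\<forall>z :: real^2. \<exists>u\<in>L. 
        \<bar>(z v* ?A)$1 - (u v* ?A)$1\<bar> \<le> 2 * R^2 / 2 \<and> \<bar>(z v* ?A)$2 - (u v* ?A)$2\<bar> \<le> 1/2"
      show "box_covers (2 * R^2) (lattice_act ?A L)"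
        unfolding box_covers_def
      proof
        fix z :: "real^2"
        obtain u where "u \<in> L" "\<bar>z$1 - (u v* ?A)$1\<bar> \<le> 2 * R^2 / 2" "\<bar>z$2 - (u v* ?A)$2\<bar> \<le> 1/2"
          using *[rule_format, of "z v* adj2 ?A"] unfolding surj[symmetric] by blast
        then show "\<exists>u\<in>lattice_act ?A L. \<bar>z$1 - u$1\<bar> \<le> 2 * R^2 / 2 \<and> \<bar>z$2 - u$2\<bar> \<le> 1/2"
          unfolding lattice_act_def by blast
      qed
    qed
  qed
  then show ?thesis unfolding norm covers_iff[OF assms] by blast
qed

section \<open>The distribution of the covering radius\<close>

text \<open>The probability that the diamond of radius \<open>R\<close> and the lattice do not cover the plane.\<close>

definition noncover_prob :: "real \<Rightarrow> real" where
  "noncover_prob R = 1 - 6 / pi\<^sup>2 * integral {-1..2 * R\<^sup>2} width_density"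

lemma noncover_prob_has_derivative:
  "(noncover_prob has_real_derivative (- (6 / pi\<^sup>2 * (width_density (2 * R\<^sup>2) * (4 * R))))) (at R)"
proof -
  have int: "((\<lambda>x. integral {-1..x} width_density) has_real_derivative width_density (2 * R\<^sup>2)) (at (2 * R\<^sup>2))"
  proof -
    have "((\<lambda>x. integral {-1..x} width_density) has_real_derivative width_density (2 * R\<^sup>2)) (at (2 * R\<^sup>2) within {-1..2 * R\<^sup>2 + 1})"
      by (rule integral_has_real_derivative) (auto intro: continuous_on_width_density order_trans[of _ 0])
    moreover have "at (2 * R\<^sup>2) within {-1..2 * R\<^sup>2 + 1} = at (2 * R\<^sup>2)"
      by (rule at_within_Icc_at) (auto intro: less_le_trans[of _ 0])
    ultimately show ?thesis by simp
  qed
  have "((\<lambda>R. 2 * R\<^sup>2) has_real_derivative 4 * R) (at R)"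
    by (auto intro!: derivative_eq_intros)
  from DERIV_chain2[OF int this]
  have "((\<lambda>R. 1 - 6 / pi\<^sup>2 * integral {-1..2 * R\<^sup>2} width_density) has_real_derivative
      (0 - 6 / pi\<^sup>2 * (width_density (2 * R\<^sup>2) * (4 * R)))) (at R)"
    by (intro DERIV_diff DERIV_const DERIV_cmult)
  then show ?thesis by (simp add: noncover_prob_def[abs_def])
qed

text \<open>The first logarithm comes from \<open>1 - 1 / t = (2 R\<^sup>2 - 1) / (2 R\<^sup>2)\<close> and the second from
  \<open>2 / t - 1 = (1 - R\<^sup>2) / R\<^sup>2\<close>, where \<open>t = 2 R\<^sup>2\<close>. The factor \<open>4 R\<close> is the derivative of \<open>t\<close>.\<close>

lemma p2_eq_width_density:
  assumes "0 \<le> R"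
  shows "p2 R = 6 / pi\<^sup>2 * (width_density (2 * R\<^sup>2) * (4 * R))"
proof (cases "R \<le> 1 / sqrt 2")
  case True
  then have "R\<^sup>2 \<le> (1 / sqrt 2)\<^sup>2" using assms by (intro power_mono)
  then have "2 * R\<^sup>2 \<le> 1" by (simp add: power_divide)
  then show ?thesis using True by (simp add: p2_def width_density_def)
next
  case False
  have "0 < 1 / sqrt 2" by simp
  then have R: "0 < R" using False by linarith
  have "(1 / sqrt 2)\<^sup>2 < R\<^sup>2" using False by (intro power_strict_mono) auto
  then have R2: "1 < 2 * R\<^sup>2" by (simp add: power_divide)
  have a: "1 - 1 / (2 * R\<^sup>2) = (2 * R\<^sup>2 - 1) / (2 * R\<^sup>2)" and b: "2 / (2 * R\<^sup>2) - 1 = (1 - R\<^sup>2) / R\<^sup>2"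
    using R by (simp_all add: field_simps)
  have A: "R * (2 * xlog (1 - 1 / (2 * R\<^sup>2))) = (2 * R\<^sup>2 - 1) / R * ln (2 * R\<^sup>2 / (2 * R\<^sup>2 - 1))"
  proof -
    have "ln (2 * R\<^sup>2 / (2 * R\<^sup>2 - 1)) = - ln ((2 * R\<^sup>2 - 1) / (2 * R\<^sup>2))"
      using R R2 by (simp add: ln_div)
    then show ?thesis
      unfolding a xlog_def using R R2 by (simp add: power2_eq_square)
  qed
  have B: "R * xlog (2 / (2 * R\<^sup>2) - 1) = (if R = 1 then 0 else (1 - R\<^sup>2) / R * ln (R\<^sup>2 / \<bar>1 - R\<^sup>2\<bar>))"
  proof (cases "R = 1")
    case False
    then have "R\<^sup>2 \<noteq> 1" using R by (simp add: power2_eq_1_iff)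
    then have "ln (R\<^sup>2 / \<bar>1 - R\<^sup>2\<bar>) = - ln \<bar>(1 - R\<^sup>2) / R\<^sup>2\<bar>"
      using R by (simp add: ln_div abs_divide)
    then show ?thesis
      unfolding b xlog_def using R False by (simp add: power2_eq_square)
  qed simp
  have "6 / pi\<^sup>2 * (width_density (2 * R\<^sup>2) * (4 * R)) =
      24 / pi\<^sup>2 * (R * (2 * xlog (1 - 1 / (2 * R\<^sup>2))) + R * xlog (2 / (2 * R\<^sup>2) - 1))"
    using R2 by (simp add: width_density_def algebra_simps)
  also have "\<dots> = p2 R" unfolding A B using False by (simp add: p2_def)
  finally show ?thesis by simp
qed

context invariant_lattice_prob
begin

text \<open>Both measures are compared with their values on the cell.\<close>

lemma basis_measure_haar:
  assumes [measurable]: "B \<in> sets borel"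
  shows "emeasure basis_measure B * ennreal (pi\<^sup>2 / 6) = emeasure basis_measure cell * haar (indicator B)"
proof -
  have "(\<integral>\<^sup>+M. indicator B M \<partial>basis_measure) * haar (indicator cell) = (\<integral>\<^sup>+M. indicator cell M \<partial>basis_measure) * haar (indicator B)"
    by (rule haar_unique[OF sigma_finite_basis_measure sets_basis_measure basis_measure_null basis_measure_invariant]) auto
  then show ?thesis by (simp add: haar_cell)
qed

lemma AE_generic: "AE L in \<mu>. generic L"
proof -
  let ?N = axis_vector_bases
  have "emeasure basis_measure ?N * ennreal (pi\<^sup>2 / 6) = 0"
    by (simp only: basis_measure_haar[OF axis_vector_bases_borel] haar_axis_vector_bases mult_zero_right)
  then have "emeasure basis_measure ?N = 0" by simp
  then have "(\<integral>\<^sup>+L. bases_count ?N L \<partial>\<mu>) = 0" by (simp only: emeasure_basis_measure[OF axis_vector_bases_borel])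
  then have "AE L in \<mu>. bases_count ?N L = 0"
    by (subst (asm) nn_integral_0_iff_AE) measurable
  moreover have "AE L in \<mu>. L \<in> X2" using AE_space[of \<mu>] by (simp add: space_mu)
  ultimately show ?thesis
  proof eventually_elim
    case (elim L)
    then obtain M where M: "M \<in> SL2R" "L = int_lattice M" by (auto simp: X2_iff)
    have "?N \<inter> bases L = {}" using elim(1) by (simp add: bases_count_def emeasure_count_space_eq_0)
    moreover have "M \<in> bases L" using M by (simp add: bases_def)
    ultimately have "M \<notin> ?N" by blast
    then show ?case using not_generic_axis[OF M(1)] M(2) by blast
  qed
qed

lemma bases_count_cell_subset:
  assumes "B \<subseteq> cell"
  shows "bases_count B L = (if B \<inter> bases L = {} then 0 else 1)"
proof (cases "B \<inter> bases L = {}")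
  case False
  then obtain M where M: "M \<in> B \<inter> bases L" by blast
  then have "B \<inter> bases L = {M}" using cell_basis_unique[of _ L M] assms by blast
  then show ?thesis by (simp add: bases_count_def)
qed (simp add: bases_count_def)

text \<open>Almost every lattice has exactly one basis in the cell.\<close>

lemma basis_measure_cell: "emeasure basis_measure cell = 1"
proof -
  have "AE L in \<mu>. L \<in> X2" using AE_space[of \<mu>] by (simp add: space_mu)
  then have "AE L in \<mu>. bases_count cell L = 1"
    using AE_generic
  proof eventually_elim
    case (elim L)
    obtain M where "M \<in> bases L" "M \<in> cell"
      using cell_basis_exists[OF elim] by blast
    then show ?case by (auto simp: bases_count_cell_subset)
  qed
  then have "(\<integral>\<^sup>+L. bases_count cell L \<partial>\<mu>) = (\<integral>\<^sup>+L. 1 \<partial>\<mu>)"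
    by (rule nn_integral_cong_AE)
  then show ?thesis by (simp add: emeasure_basis_measure emeasure_space_1)
qed

definition wide_lattices :: "real \<Rightarrow> (real^2) set set" where
  "wide_lattices T = {L \<in> X2. wide_cell T \<inter> bases L \<noteq> {}}"

lemma wide_lattices_eq: "wide_lattices T = {L \<in> space \<mu>. bases_count (wide_cell T) L \<noteq> 0}"
  by (auto simp: wide_lattices_def space_mu bases_count_def emeasure_count_space_eq_0)

lemma wide_lattices_sets [measurable]: "wide_lattices T \<in> sets \<mu>"
  unfolding wide_lattices_eq by measurable

text \<open>Each lattice has at most one basis in the cell, so the measure of a subset of the cell is the
  probability that the canonical basis falls into it.\<close>

lemma measure_wide_lattices:
  assumes "0 < T"
  shows "measure \<mu> (wide_lattices T) = 1 - 6 / pi\<^sup>2 * integral {-1..T} width_density"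
proof -
  have sub: "wide_cell T \<subseteq> cell" by (auto simp: wide_cell_def)
  have "emeasure \<mu> (wide_lattices T) = (\<integral>\<^sup>+L. indicator (wide_lattices T) L \<partial>\<mu>)" by simp
  also have "\<dots> = (\<integral>\<^sup>+L. bases_count (wide_cell T) L \<partial>\<mu>)"
  proof (rule nn_integral_cong)
    fix L assume "L \<in> space \<mu>"
    then have "L \<in> wide_lattices T \<longleftrightarrow> wide_cell T \<inter> bases L \<noteq> {}"
      by (simp only: wide_lattices_def space_mu mem_Collect_eq simp_thms)
    then show "indicator (wide_lattices T) L = bases_count (wide_cell T) L"
      unfolding bases_count_cell_subset[OF sub] by (cases "wide_cell T \<inter> bases L = {}") simp_all
  qed
  also have "\<dots> = emeasure basis_measure (wide_cell T)" by (simp add: emeasure_basis_measure)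
  finally have "ennreal (measure \<mu> (wide_lattices T)) * ennreal (pi\<^sup>2 / 6) =
      ennreal (pi\<^sup>2 / 6 - integral {-1..T} width_density)"
    using basis_measure_haar[OF wide_cell_borel, of T] by (simp add: basis_measure_cell haar_wide_cell_eq[OF assms] emeasure_eq_measure)
  then have "ennreal (measure \<mu> (wide_lattices T) * (pi\<^sup>2 / 6)) = ennreal (pi\<^sup>2 / 6 - integral {-1..T} width_density)"
    by (subst ennreal_mult) auto
  then have "measure \<mu> (wide_lattices T) * (pi\<^sup>2 / 6) = pi\<^sup>2 / 6 - integral {-1..T} width_density"
    using haar_wide_cell_eq(2)[OF assms] by (subst (asm) ennreal_inj) auto
  then show ?thesis by (simp add: field_simps)
qed

lemma generic_covers_iff_narrow:
  assumes "L \<in> X2" "generic L"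
  shows "box_covers T L \<longleftrightarrow> L \<notin> wide_lattices T"
proof -
  obtain M where M: "M \<in> bases L" "M \<in> cell"
    using cell_basis_exists[OF assms] by blast
  have "N = M" if "N \<in> cell" "N \<in> bases L" for N
    by (rule cell_basis_unique[of N L M]) (use that M in blast)+
  then have "cell \<inter> bases L = {M}" using M by blast
  then have "wide_cell T \<inter> bases L = (if T < M$1$1 + M$2$1 then {M} else {})"
    by (auto simp: wide_cell_def)
  then have "L \<in> wide_lattices T \<longleftrightarrow> T < M$1$1 + M$2$1"
    using assms(1) by (simp add: wide_lattices_def)
  then show ?thesis
    using wide_cell_not_covering[OF M(2,1)] narrow_cell_covering[OF assms(1) M(2,1)] by force
qed

lemma measure_box_frame:
  assumes "R \<noteq> 0"
  shows "measure \<mu> (lattice_act (box_frame R) -` wide_lattices T \<inter> X2) = measure \<mu> (wide_lattices T)"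
proof -
  have "measure \<mu> (wide_lattices T) = measure (distr \<mu> \<mu> (lattice_act (box_frame R))) (wide_lattices T)"
    by (simp add: distr_lattice_act[OF box_frame_SL2R[OF assms]])
  also have "\<dots> = measure \<mu> (lattice_act (box_frame R) -` wide_lattices T \<inter> space \<mu>)"
    by (rule measure_distr[OF measurable_lattice_act_mu[OF box_frame_SL2R[OF assms]]]) measurable
  finally show ?thesis by (simp add: space_mu)
qed

lemma AE_covers_iff:
  assumes "0 < R"
  shows "AE L in \<mu>. covers R L \<longleftrightarrow> L \<notin> lattice_act (box_frame R) -` wide_lattices (2 * R\<^sup>2) \<inter> X2"
proof -
  have A: "box_frame R \<in> SL2R" using assms by (intro box_frame_SL2R) simp
  have "AE L in \<mu>. L \<in> X2" using AE_space[of \<mu>] by (simp add: space_mu)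
  moreover have "AE L in distr \<mu> \<mu> (lattice_act (box_frame R)). generic L"
    unfolding distr_lattice_act[OF A] by (rule AE_generic)
  then have "AE L in \<mu>. generic (lattice_act (box_frame R) L)"
    by (rule AE_distrD[OF measurable_lattice_act_mu[OF A]])
  ultimately show ?thesis
    by eventually_elim
       (simp add: covers_iff_box_covers[OF assms] generic_covers_iff_narrow lattice_act_X2[OF A])
qed

lemma measure_not_covers:
  assumes "0 < R"
  shows "measure \<mu> (lattice_act (box_frame R) -` wide_lattices (2 * R\<^sup>2) \<inter> X2) = noncover_prob R"
  using assms by (simp add: measure_box_frame measure_wide_lattices noncover_prob_def)

lemma not_covers_sets:
  assumes "0 < R"
  shows "lattice_act (box_frame R) -` wide_lattices T \<inter> X2 \<in> sets \<mu>"
  using measurable_sets[OF measurable_lattice_act_mu[OF box_frame_SL2R] wide_lattices_sets] assms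
  by (simp add: space_mu)

lemma covering_set_sets:
  assumes "0 \<le> R"
  shows "{L \<in> X2. R < covering_radius cross_polytope L} \<in> sets \<mu>"
  using covering_radius_gt_measurable[OF assms] by (simp add: sets_mu)

lemma P2_le_noncover_prob:
  assumes "0 < R"
  shows "P2 \<mu> R \<le> noncover_prob R"
  unfolding P2_def measure_not_covers[OF assms, symmetric]
proof (rule finite_measure_mono_AE)
  show "AE L in \<mu>. L \<in> {L \<in> X2. R < covering_radius cross_polytope L} \<longrightarrow>
      L \<in> lattice_act (box_frame R) -` wide_lattices (2 * R\<^sup>2) \<inter> X2"
    using AE_covers_iff[OF assms]
  proof eventually_elim
    case (elim L)
    show ?case
    proof
      assume "L \<in> {L \<in> X2. R < covering_radius cross_polytope L}"
      then have "R < covering_radius cross_polytope L" by blast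
      then have "\<not> covers R L" using covering_radius_le[OF assms, of L] by linarith
      then show "L \<in> lattice_act (box_frame R) -` wide_lattices (2 * R\<^sup>2) \<inter> X2"
        using elim by blast
    qed
  qed
qed (rule not_covers_sets[OF assms])

lemma noncover_prob_le_P2:
  assumes "0 \<le> R" "R < R'"
  shows "noncover_prob R' \<le> P2 \<mu> R"
proof -
  have R': "0 < R'" using assms by simp
  show ?thesis
    unfolding P2_def measure_not_covers[OF R', symmetric]
  proof (rule finite_measure_mono_AE)
    show "AE L in \<mu>. L \<in> lattice_act (box_frame R') -` wide_lattices (2 * R'\<^sup>2) \<inter> X2 \<longrightarrow>
        L \<in> {L \<in> X2. R < covering_radius cross_polytope L}"
      using AE_covers_iff[OF R']
    proof eventually_elim
      case (elim L)
      show ?case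
      proof
        assume L: "L \<in> lattice_act (box_frame R') -` wide_lattices (2 * R'\<^sup>2) \<inter> X2"
        then have "L \<in> X2" "\<not> covers R' L" using elim by blast+
        then show "L \<in> {L \<in> X2. R < covering_radius cross_polytope L}"
          using covering_radius_ge[OF _ R', of L] assms by simp
      qed
    qed
  qed (rule covering_set_sets[OF assms(1)])
qed

text \<open>The event \<open>R < \<rho>\<close> is contained in noncovering at \<open>R\<close> and contains noncovering at every larger radius, and the
  probability of noncovering is continuous in the radius. At \<open>R = 0\<close> the upper bound is the trivial bound \<open>1\<close>.\<close>

lemma P2_eq_noncover_prob:
  assumes "0 \<le> R"
  shows "P2 \<mu> R = noncover_prob R"
proof (rule antisym)
  show "P2 \<mu> R \<le> noncover_prob R"
  proof (cases "R = 0")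
    case True
    have "integral {-1..0} width_density = 0"
      using integral_cong[of "{-1..0}" width_density "\<lambda>_. 0"] by (simp add: width_density_def)
    then show ?thesis using True by (simp add: noncover_prob_def P2_def)
  qed (use assms in \<open>simp add: P2_le_noncover_prob\<close>)
  have "(noncover_prob \<longlongrightarrow> noncover_prob R) (at R)"
    using DERIV_isCont[OF noncover_prob_has_derivative] by (simp add: isCont_def)
  then have "(noncover_prob \<longlongrightarrow> noncover_prob R) (at_right R)"
    by (rule filterlim_mono) (auto simp: at_le)
  moreover have "eventually (\<lambda>x. noncover_prob x \<le> P2 \<mu> R) (at_right R)"
    using eventually_at_right_less[of R] by eventually_elim (rule noncover_prob_le_P2[OF assms])
  ultimately show "noncover_prob R \<le> P2 \<mu> R"
    by (rule tendsto_upperbound) simp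
qed

end

theorem proposition3:
  fixes \<mu>\<^sub>0 :: "(real^2) set measure" and R :: real
  assumes "is_invariant_prob \<mu>\<^sub>0" and "R \<ge> 0"
  shows "(P2 \<mu>\<^sub>0 has_real_derivative - p2 R) (at R within {0..})"
proof -
  interpret invariant_lattice_prob \<mu>\<^sub>0 using assms(1) by unfold_locales
  have "(noncover_prob has_real_derivative - p2 R) (at R within {0..})"
    unfolding p2_eq_width_density[OF assms(2)] by (rule has_field_derivative_at_within[OF noncover_prob_has_derivative])
  then show ?thesis
    by (rule has_field_derivative_transform_within[where d=1])
       (use assms(2) in \<open>auto simp: P2_eq_noncover_prob\<close>)
qed

end
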